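(* Let $\Gamma=(X,\mathcal{R})$ be a non-bipartite distance-regular graph with diameter $D\ge3$ having classical parameters $(D,1,\alpha,\beta)$, and fix $x\in X$. If $\Gamma$ is tight, then $\Gamma$ does not support a uniform structure with respect to $x$.
   Context: All graphs are finite, simple, connected and undirected, with distance $\partial$. For fixed $x$ of eccentricity $\varepsilon$: $V=\mathbb{C}^X$, $A$ the adjacency matrix, $E_i^*$ the diagonal $0/1$ matrix with $(y,y)$-entry $1$ iff $\partial(x,y)=i$; $L=\sum_{i=1}^{\varepsilon}E^*_{i-1}AE^*_i$, $R=\sum_{i=0}^{\varepsilon-1}E^*_{i+1}AE^*_i=L^\top$. $\Gamma_f$ is the graph on $X$ whose edges are the edges $yz$ of $\Gamma$ with $\partial(x,y)\ne\partial(x,z)$ (bipartite with lowering/raising matrices $L,R$). A parameter matrix is a tridiagonal complex $U=(e_{ij})_{1\le i,j\le\varepsilon}$ with $e_{ii}=1$, with $e_{i,i-1}\ne0$ for all $2\le i\le\varepsilon$ or $e_{i-1,i}\ne0$ for all $2\le i\le\varepsilon$, and every principal submatrix $(e_{ij})_{s\le i,j\le t}$ nonsingular; $e_i^-=e_{i,i-1}$, $e_i^+=e_{i,i+1}$, $e_1^-=e_\varepsilon^+=0$. A bipartite graph admits a uniform structure w.r.t. $x$ if there exist such $U$ and $f\in\mathbb{C}^\varepsilon$ with $e_i^-RL^2+LRL+e_i^+L^2R=f_iL$ on $E_i^*V$ for all $1\le i\le\varepsilon$; a non-bipartite $\Gamma$ supports a uniform structure w.r.t. $x$ if $\Gamma_f$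 admits one. Distance-regular: $p^h_{ij}=|\{w:\partial(y,w)=i,\partial(z,w)=j\}|$ depends only on $h=\partial(y,z),i,j$; $c_i=p^i_{1,i-1}$, $a_i=p^i_{1,i}$, $b_i=p^i_{1,i+1}$. Classical parameters $(D,1,\alpha,\beta)$: $c_i=i(1+\alpha(i-1))$, $b_i=(D-i)(\beta-\alpha i)$. With $\theta_0>\theta_1>\dots>\theta_D$ the distinct adjacency eigenvalues, $\Gamma$ is tight if $\left(\theta_1+\frac{b_0}{a_1+1}\right)\left(\theta_D+\frac{b_0}{a_1+1}\right)=-\frac{b_0a_1b_1}{(a_1+1)^2}$. *)

theory Defs
  imports "HOL-Analysis.Analysis" "Jordan_Normal_Form.Determinant"
begin

(* A graph is its adjacency relation; the vertex set X is the whole (finite) type 'a, so that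
   C^X is the type complex^'a and matrices indexed by X have type complex^'a^'a. *)

type_synonym 'a graph = "'a \<Rightarrow> 'a \<Rightarrow> bool"

definition simple_connected_graph :: "'a::finite graph \<Rightarrow> bool" where
  "simple_connected_graph E \<longleftrightarrow> symp E \<and> irreflp E \<and> (\<forall>y z. E\<^sup>*\<^sup>* y z)"

definition bipartite_graph :: "'a::finite graph \<Rightarrow> bool" where
  "bipartite_graph E \<longleftrightarrow> (\<exists>S. \<forall>y z. E y z \<longrightarrow> (y \<in> S \<longleftrightarrow> z \<notin> S))"

(* The relation power (E ^^ n) y z says that there is a walk of length n from y to z. *)
definition gdist :: "'a::finite graph \<Rightarrow> 'a \<Rightarrow> 'a \<Rightarrow> nat" where
  "gdist E y z = (LEAST n. (E ^^ n) y z)"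

definition eccentricity :: "'a::finite graph \<Rightarrow> 'a \<Rightarrow> nat" where
  "eccentricity E x = Max {gdist E x y | y. True}"

definition graph_diameter :: "'a::finite graph \<Rightarrow> nat" where
  "graph_diameter E = Max {gdist E y z | y z. True}"

definition adj_matrix :: "'a::finite graph \<Rightarrow> complex^'a^'a" where
  "adj_matrix E = (\<chi> y z. if E y z then 1 else 0)"

definition Estar :: "'a::finite graph \<Rightarrow> 'a \<Rightarrow> nat \<Rightarrow> complex^'a^'a" where
  "Estar E x i = (\<chi> y z. if y = z \<and> gdist E x y = i then 1 else 0)"

definition lowering :: "'a::finite graph \<Rightarrow> 'a \<Rightarrow> complex^'a^'a" where
  "lowering E x =
     (\<Sum>i\<in>{1..eccentricity E x}. Estar E x (i - 1) ** adj_matrix E ** Estar E x i)"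

definition raising :: "'a::finite graph \<Rightarrow> 'a \<Rightarrow> complex^'a^'a" where
  "raising E x =
     (\<Sum>i\<in>{0..<eccentricity E x}. Estar E x (i + 1) ** adj_matrix E ** Estar E x i)"

definition Estar_space :: "'a::finite graph \<Rightarrow> 'a \<Rightarrow> nat \<Rightarrow> (complex^'a) set" where
  "Estar_space E x i = range (\<lambda>v. Estar E x i *v v)"

(* The graph called Gamma_f: edges joining vertices equidistant from x are removed. *)
definition flat_graph :: "'a::finite graph \<Rightarrow> 'a \<Rightarrow> 'a graph" where
  "flat_graph E x = (\<lambda>y z. E y z \<and> gdist E x y \<noteq> gdist E x z)"

(* The matrix U = (e_ij), 1 <= i,j <= n, is a function of two indices; its values outside
   this range are irrelevant. *)
definition parameter_matrix :: "nat \<Rightarrow> (nat \<Rightarrow> nat \<Rightarrow> complex) \<Rightarrow> bool" where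
  "parameter_matrix n U \<longleftrightarrow>
     (\<forall>i\<in>{1..n}. U i i = 1) \<and>
     (\<forall>i\<in>{1..n}. \<forall>j\<in>{1..n}. i + 1 < j \<or> j + 1 < i \<longrightarrow> U i j = 0) \<and>
     ((\<forall>i\<in>{2..n}. U i (i - 1) \<noteq> 0) \<or> (\<forall>i\<in>{2..n}. U (i - 1) i \<noteq> 0)) \<and>
     (\<forall>s t. 1 \<le> s \<and> s \<le> t \<and> t \<le> n \<longrightarrow>
        Determinant.det
          (Matrix.mat (t + 1 - s) (t + 1 - s) (\<lambda>(i, j). U (s + i) (s + j))) \<noteq> 0)"

definition e_minus :: "(nat \<Rightarrow> nat \<Rightarrow> complex) \<Rightarrow> nat \<Rightarrow> complex" where
  "e_minus U i = (if i = 1 then 0 else U i (i - 1))"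

definition e_plus :: "nat \<Rightarrow> (nat \<Rightarrow> nat \<Rightarrow> complex) \<Rightarrow> nat \<Rightarrow> complex" where
  "e_plus n U i = (if i = n then 0 else U i (i + 1))"

(* Only meant for bipartite E. *)
definition admits_uniform_structure :: "'a::finite graph \<Rightarrow> 'a \<Rightarrow> bool" where
  "admits_uniform_structure E x \<longleftrightarrow>
     (let n = eccentricity E x; L = lowering E x; R = raising E x in
      \<exists>U f. parameter_matrix n U \<and>
        (\<forall>i\<in>{1..n}. \<forall>v\<in>Estar_space E x i.
           e_minus U i *s ((R ** L ** L) *v v) + (L ** R ** L) *v v
             + e_plus n U i *s ((L ** L ** R) *v v)
           = (f :: nat \<Rightarrow> complex) i *s (L *v v)))"

(* Only meant for non-bipartite E. *)
definition supports_uniform_structure :: "'a::finite graph \<Rightarrow> 'a \<Rightarrow> bool" where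
  "supports_uniform_structure E x \<longleftrightarrow> admits_uniform_structure (flat_graph E x) x"

definition p_set :: "'a::finite graph \<Rightarrow> 'a \<Rightarrow> 'a \<Rightarrow> nat \<Rightarrow> nat \<Rightarrow> 'a set" where
  "p_set E y z i j = {w. gdist E y w = i \<and> gdist E z w = j}"

definition distance_regular :: "'a::finite graph \<Rightarrow> bool" where
  "distance_regular E \<longleftrightarrow>
     (\<forall>i j y z y' z'. gdist E y z = gdist E y' z' \<longrightarrow>
        card (p_set E y z i j) = card (p_set E y' z' i j))"

(* For a distance-regular graph and h at most the diameter, this is the common value of
   card (p_set E y z i j) over all y, z at distance h. *)
definition intersection_number :: "'a::finite graph \<Rightarrow> nat \<Rightarrow> nat \<Rightarrow> nat \<Rightarrow> nat" where
  "intersection_number E h i j = (THE n. \<forall>y z. gdist E y z = h \<longrightarrow> card (p_set E y z i j) = n)"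

(* c_number is meant for i >= 1 only, because of the truncated subtraction. *)
definition c_number :: "'a::finite graph \<Rightarrow> nat \<Rightarrow> nat" where
  "c_number E i = intersection_number E i 1 (i - 1)"

definition a_number :: "'a::finite graph \<Rightarrow> nat \<Rightarrow> nat" where
  "a_number E i = intersection_number E i 1 i"

definition b_number :: "'a::finite graph \<Rightarrow> nat \<Rightarrow> nat" where
  "b_number E i = intersection_number E i 1 (i + 1)"

(* Classical parameters (D, q, alpha, beta) with q = 1. *)
definition classical_parameters_q1 :: "'a::finite graph \<Rightarrow> nat \<Rightarrow> real \<Rightarrow> real \<Rightarrow> bool" where
  "classical_parameters_q1 E D \<alpha> \<beta> \<longleftrightarrow>
     graph_diameter E = D \<and>
     (\<forall>i\<in>{1..D}. real (c_number E i) = real i * (1 + \<alpha> * (real i - 1))) \<and>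
     (\<forall>i\<in>{0..<D}. real (b_number E i) = (real D - real i) * (\<beta> - \<alpha> * real i))"

(* Adjacency matrices are real symmetric, so looking for real eigenvalues only is no loss. *)
definition graph_eigenvalues :: "'a::finite graph \<Rightarrow> real set" where
  "graph_eigenvalues E =
     {\<theta>. \<exists>v. v \<noteq> 0 \<and> adj_matrix E *v v = complex_of_real \<theta> *s v}"

(* theta E i is the i-th largest distinct eigenvalue, counted from 0. *)
definition theta :: "'a::finite graph \<Rightarrow> nat \<Rightarrow> real" where
  "theta E i = rev (sorted_list_of_set (graph_eigenvalues E)) ! i"

definition tight_graph :: "'a::finite graph \<Rightarrow> bool" where
  "tight_graph E \<longleftrightarrow>
     (let a1 = real (a_number E 1); b0 = real (b_number E 0); b1 = real (b_number E 1);
          D = graph_diameter E in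
      (theta E 1 + b0 / (a1 + 1)) * (theta E D + b0 / (a1 + 1))
        = - (b0 * a1 * b1 / (a1 + 1)\<^sup>2))"

end

theory Submission
  imports Defs
begin

text \<open>The adjacency matrix acts on functions of the distance to a vertex by a bidiagonal matrix in the
  basis of binomial coefficients, so the eigenvalues are \<open>ev n = b\<^sub>n - n\<close> (with the formula for b extended
  to n = D), and tightness becomes \<open>\<beta> = 1 + \<alpha> (D - 1)\<close>. Then \<open>b\<^sub>i = c\<^bsub>D-i\<^esub>\<close>, so every vertex has a unique
  antipode. By the equality case of the fundamental bound, the local graphs have, besides the
  valency, only the eigenvalues -2 and \<open>\<zeta> = \<alpha> (D - 2)\<close>. Let N be the space of vectors on the first
  subconstituent with coordinate sum zero. On N the map LR is a polynomial in the local adjacency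
  matrix, and it is not scalar. On the other hand \<open>R\<^bsup>D-1\<^esup>\<close> kills N because the last subconstituent is
  a single vertex, while \<open>R\<^bsup>D-2\<^esup>\<close> is injective on N because -1 is not a local eigenvalue; with these
  facts, the tridiagonal system of a uniform structure forces LR to be scalar on N. The argument is
  carried out at the antipode of x, where the roles of L and R are exchanged and the uniform
  equations need not be transposed.\<close>

section \<open>Graph distance\<close>

lemma gdist_le_walk: "(E ^^ n) y z \<Longrightarrow> gdist E y z \<le> n"
  unfolding gdist_def by (rule Least_le)

locale sc_graph =
  fixes E :: "'a::finite graph"
  assumes scg: "simple_connected_graph E"
begin

abbreviation d :: "'a \<Rightarrow> 'a \<Rightarrow> nat" where "d \<equiv> gdist E"

lemma E_sym: "E y z \<Longrightarrow> E z y"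
  using scg by (auto simp: simple_connected_graph_def dest: sympD)

lemma E_irrefl: "\<not> E y y"
  using scg by (auto simp: simple_connected_graph_def dest: irreflpD)

lemma geodesic: "(E ^^ d y z) y z"
proof -
  have "E\<^sup>*\<^sup>* y z" using scg by (auto simp: simple_connected_graph_def)
  then have "\<exists>n. (E ^^ n) y z" by (rule rtranclp_imp_relpowp)
  then show ?thesis unfolding gdist_def by (rule LeastI_ex)
qed

lemma d_triangle: "d y w \<le> d y z + d z w"
proof -
  have "(E ^^ (d y z + d z w)) y w"
    using geodesic[of y z] geodesic[of z w] by (auto simp: relpowp_add)
  then show ?thesis by (rule gdist_le_walk)
qed

lemma d_sym: "d y z = d z y"
proof -
  have rev: "(E ^^ n) y z \<Longrightarrow> (E ^^ n) z y" for n y z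
  proof (induction n arbitrary: y z)
    case (Suc n)
    then obtain w where "(E ^^ n) y w" "E w z" by auto
    then show ?case using Suc.IH E_sym by (blast intro: relpowp_Suc_I2)
  qed auto
  show ?thesis
    using gdist_le_walk[OF rev[OF geodesic], of y z] gdist_le_walk[OF rev[OF geodesic], of z y] by simp
qed

lemma d_eq_0 [simp]: "d y z = 0 \<longleftrightarrow> y = z"
proof
  show "d y z = 0 \<Longrightarrow> y = z" using geodesic[of y z] by simp
  show "y = z \<Longrightarrow> d y z = 0" using gdist_le_walk[of 0 E y z] by simp
qed

lemma d_self [simp]: "d y y = 0" by simp

lemma d_eq_1: "d y z = 1 \<longleftrightarrow> E y z"
proof
  show "d y z = 1 \<Longrightarrow> E y z" using geodesic[of y z] by auto
  assume e: "E y z"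
  then have "d y z \<le> 1" using gdist_le_walk[of 1 E y z] by auto
  moreover have "d y z \<noteq> 0" using e E_irrefl by auto
  ultimately show "d y z = 1" by linarith
qed

lemma d_step: "E z w \<Longrightarrow> d y w \<le> d y z + 1"
  using d_triangle[of y w z] d_eq_1[of z w] by simp

lemma d_step_cases:
  assumes "E z w"
  shows "d y w = d y z + 1 \<or> d y w = d y z \<or> d y w + 1 = d y z"
  using d_step[OF assms, of y] d_step[OF E_sym[OF assms], of y] by linarith

lemma geodesic_pred:
  assumes "d y z = Suc n"
  obtains w where "E z w" "d y w = n"
proof -
  have "(E ^^ Suc n) y z" using geodesic[of y z] assms by simp
  then obtain w where w: "(E ^^ n) y w" "E w z" by auto
  have "d y w \<le> n" using w(1) by (rule gdist_le_walk)
  moreover have "Suc n \<le> d y w + 1" using d_step[OF w(2), of y] assms by simp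
  ultimately show thesis using that[of w] E_sym[OF w(2)] by simp
qed

text \<open>Downward induction from \<open>z\<close>, stepping to predecessors nearer to
  \<open>y\<close>. Together with a diametral pair it yields pairs at every distance up to the
  diameter.\<close>

lemma geodesic_point:
  assumes "i \<le> d y z"
  obtains w where "d y w = i" "d w z = d y z - i"
proof -
  have "\<exists>w. d y w = i \<and> d w z = d y z - i" using assms
  proof (induction "d y z - i" arbitrary: i)
    case 0
    then show ?case by (intro exI[of _ z]) auto
  next
    case (Suc n)
    have "n = d y z - Suc i" "Suc i \<le> d y z" using Suc.hyps(2) by auto
    then obtain w where w: "d y w = Suc i" "d w z = d y z - Suc i"
      using Suc.hyps(1) by blast
    obtain u where u: "E w u" "d y u = i" using geodesic_pred[OF w(1)] by blast
    have "d u z \<le> d y z - i"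
      using d_step[OF u(1), of z] w(2) Suc.hyps(2) d_sym[of u z] d_sym[of w z] by simp
    moreover have "d y z \<le> d y u + d u z" by (rule d_triangle)
    ultimately show ?case using u(2) by (intro exI[of _ u]) auto
  qed
  then show thesis using that by blast
qed

lemma d_le_diameter: "d y z \<le> graph_diameter E"
proof -
  have "{d y z |y z. True} = (\<lambda>(y, z). d y z) ` UNIV" by auto
  then have "finite {d y z |y z. True}" by simp
  then show ?thesis unfolding graph_diameter_def by (intro Max_ge) auto
qed

lemma diametral_pair: obtains y z where "d y z = graph_diameter E"
proof -
  have "{d y z |y z. True} = (\<lambda>(y, z). d y z) ` UNIV" by auto
  then have "finite {d y z |y z. True}" by simp
  moreover have "{d y z |y z. True} \<noteq> {}" by auto
  ultimately have "graph_diameter E \<in> {d y z |y z. True}"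
    unfolding graph_diameter_def by (rule Max_in)
  then show thesis using that by auto
qed

lemma intersection_number_eq:
  assumes "distance_regular E" "d y z = h"
  shows "intersection_number E h i j = card (p_set E y z i j)"
  unfolding intersection_number_def
proof (rule the_equality)
  show "\<forall>y' z'. d y' z' = h \<longrightarrow> card (p_set E y' z' i j) = card (p_set E y z i j)"
    using assms unfolding distance_regular_def by metis
qed (use assms in blast)

text \<open>Consecutive vertices of a geodesic from \<open>x\<close> have different distances to
  \<open>x\<close>, so its edges survive in the flat graph.\<close>

lemma flat_walk:
  assumes "d x y = n"
  shows "(flat_graph E x ^^ n) x y"
  using assms
proof (induction n arbitrary: y)
  case (Suc n)
  obtain w where w: "E y w" "d x w = n" using geodesic_pred[OF Suc.prems] by blast
  have "flat_graph E x w y" using w Suc.prems E_sym by (auto simp: flat_graph_def)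
  then show ?case using Suc.IH[OF w(2)] by (intro relpowp_Suc_I)
qed simp

text \<open>Hence both graphs have the same subconstituents at \<open>x\<close>, and L and R of the
  flat graph can be computed with distances of \<open>E\<close>.\<close>

lemma gdist_flat: "gdist (flat_graph E x) x y = d x y"
proof (rule antisym)
  show "gdist (flat_graph E x) x y \<le> d x y" using flat_walk gdist_le_walk by blast
  have mono: "(flat_graph E x ^^ n) x z \<Longrightarrow> (E ^^ n) x z" for n z
    by (induction n arbitrary: z) (auto simp: flat_graph_def)
  have "(flat_graph E x ^^ gdist (flat_graph E x) x y) x y"
    unfolding gdist_def[of "flat_graph E x"] by (rule LeastI, rule flat_walk, rule refl)
  then show "d x y \<le> gdist (flat_graph E x) x y" using mono gdist_le_walk by blast
qed

end

section \<open>Classical parameters with q = 1 and the spectrum\<close>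

locale classical_q1 = sc_graph E for E :: "'a::finite graph" +
  fixes D :: nat and \<alpha> \<beta> :: real
  assumes dr: "distance_regular E"
    and D3: "D \<ge> 3"
    and classical: "classical_parameters_q1 E D \<alpha> \<beta>"
begin

text \<open>The formulas are taken at all indices: \<open>bb D = 0\<close> and
  \<open>cc 0 = 0\<close> match the empty neighbour sets at the two ends, so the counting lemmas
  need no bounds on \<open>i\<close>.\<close>

definition bb :: "nat \<Rightarrow> real" where "bb i = (real D - real i) * (\<beta> - \<alpha> * real i)"
definition cc :: "nat \<Rightarrow> real" where "cc i = real i * (1 + \<alpha> * (real i - 1))"
definition aa :: "nat \<Rightarrow> real" where "aa i = bb 0 - bb i - cc i"

lemma diameter_D: "graph_diameter E = D"
  using classical by (simp add: classical_parameters_q1_def)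

lemma d_le_D: "d y z \<le> D"
  using d_le_diameter diameter_D by metis

lemma pair_at:
  assumes "i \<le> D"
  obtains y z where "d y z = i"
proof -
  obtain y z where "d y z = D" using diametral_pair diameter_D by metis
  then show thesis using geodesic_point[of i y z] assms that by metis
qed

lemma card_b:
  assumes "d y z = i"
  shows "real (card {w. E z w \<and> d y w = i + 1}) = bb i"
proof (cases "i < D")
  case True
  have "intersection_number E i 1 (i + 1) = card (p_set E z y 1 (i + 1))"
    by (rule intersection_number_eq) (use dr assms d_sym in auto)
  moreover have "p_set E z y 1 (i + 1) = {w. E z w \<and> d y w = i + 1}"
    by (auto simp: p_set_def d_eq_1[symmetric])
  moreover have "real (b_number E i) = bb i"
    using classical True by (simp add: classical_parameters_q1_def bb_def)
  ultimately show ?thesis by (simp add: b_number_def)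
next
  case False
  then have "i = D" using d_le_D[of y z] assms by simp
  moreover have "{w. E z w \<and> d y w = D + 1} = {}"
    using d_le_D by (auto simp: not_le dest: spec)
      (metis Suc_n_not_le_n)
  ultimately show ?thesis by (simp add: bb_def)
qed

lemma card_c:
  assumes "d y z = i"
  shows "real (card {w. E z w \<and> d y w + 1 = i}) = cc i"
proof (cases "i = 0")
  case True
  then show ?thesis by (simp add: cc_def)
next
  case False
  have "intersection_number E i 1 (i - 1) = card (p_set E z y 1 (i - 1))"
    by (rule intersection_number_eq) (use dr assms d_sym in auto)
  moreover have "p_set E z y 1 (i - 1) = {w. E z w \<and> d y w + 1 = i}"
    using False by (auto simp: p_set_def d_eq_1[symmetric])
  moreover have "real (c_number E i) = cc i"
    using classical False assms d_le_D[of y z]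
    by (auto simp: classical_parameters_q1_def cc_def)
  ultimately show ?thesis by (simp add: c_number_def)
qed

lemma card_nbrs: "real (card {w. E z w}) = bb 0"
proof -
  have "{w. E z w} = {w. E z w \<and> d z w = 0 + 1}"
    using d_eq_1 by auto
  then show ?thesis using card_b[of z z 0] by simp
qed

text \<open>The neighbours of \<open>z\<close> split by their distance i - 1, i or i + 1 to
  \<open>y\<close>. For \<open>i = 0\<close> the truncated index \<open>i - 1\<close> is harmless
  because \<open>cc 0 = 0\<close>.\<close>

lemma nbr_sum:
  fixes \<phi> :: "nat \<Rightarrow> real"
  assumes "d y z = i"
  shows "(\<Sum>w | E z w. \<phi> (d y w)) = cc i * \<phi> (i - 1) + aa i * \<phi> i + bb i * \<phi> (i + 1)"
proof -
  let ?C = "{w. E z w \<and> d y w + 1 = i}" and ?A = "{w. E z w \<and> d y w = i}"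
    and ?B = "{w. E z w \<and> d y w = i + 1}"
  have un: "{w. E z w} = ?C \<union> (?A \<union> ?B)"
    using d_step_cases[of z _ y] assms by auto
  have dj: "?C \<inter> (?A \<union> ?B) = {}" "?A \<inter> ?B = {}" by auto
  have "card {w. E z w} = card ?C + (card ?A + card ?B)"
    unfolding un using dj by (subst card_Un_disjoint; simp)+
  then have a: "real (card ?A) = aa i"
    using card_nbrs[of z] card_b[OF assms] card_c[OF assms] by (simp add: aa_def)
  have "(\<Sum>w | E z w. \<phi> (d y w)) = sum (\<lambda>w. \<phi> (d y w)) ?C + (sum (\<lambda>w. \<phi> (d y w)) ?A + sum (\<lambda>w. \<phi> (d y w)) ?B)"
    unfolding un using dj by (subst sum.union_disjoint; simp)+
  also have "sum (\<lambda>w. \<phi> (d y w)) ?C = sum (\<lambda>w. \<phi> (i - 1)) ?C"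
    by (rule sum.cong) auto
  also have "sum (\<lambda>w. \<phi> (d y w)) ?A = sum (\<lambda>w. \<phi> i) ?A"
    by (rule sum.cong) auto
  also have "sum (\<lambda>w. \<phi> (d y w)) ?B = sum (\<lambda>w. \<phi> (i + 1)) ?B"
    by (rule sum.cong) auto
  finally show ?thesis
    using a card_b[OF assms] card_c[OF assms] by simp
qed

lemma card_a:
  assumes "d y z = i"
  shows "real (card {w. E z w \<and> d y w = i}) = aa i"
proof -
  have "real (card {w. E z w \<and> d y w = i}) = (\<Sum>w | E z w. if d y w = i then 1 else 0)"
    by (simp add: sum.If_cases Int_def)
  then show ?thesis
    using nbr_sum[OF assms, of "\<lambda>j. if j = i then 1 else 0"] by (cases i) (auto simp: cc_def)
qed

lemma bb_pos:
  assumes "i < D"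
  shows "bb i > 0"
proof -
  obtain z y where zy: "d z y = Suc i" using pair_at[of "Suc i"] assms by auto
  obtain w where w: "E y w" "d z w = i" using geodesic_pred[OF zy] by blast
  have "y \<in> {u. E w u \<and> d z u = i + 1}" using w zy E_sym by auto
  then have "card {u. E w u \<and> d z u = i + 1} > 0" by (auto simp: card_gt_0_iff)
  then show ?thesis using card_b[OF w(2)] by linarith
qed

lemma cc_ge_1:
  assumes "1 \<le> i" "i \<le> D"
  shows "cc i \<ge> 1"
proof -
  obtain n where n: "i = Suc n" using assms(1) by (cases i) auto
  obtain z y where zy: "d z y = Suc n" using pair_at[of i] assms n by auto
  obtain w where w: "E y w" "d z w = n" using geodesic_pred[OF zy] by blast
  have "w \<in> {u. E y u \<and> d z u + 1 = i}" using w n by auto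
  then have "card {u. E y u \<and> d z u + 1 = i} > 0" by (auto simp: card_gt_0_iff)
  then show ?thesis using card_c[of z y i] zy n by linarith
qed

text \<open>Integrality does the work: \<open>cc 3 > 0\<close> gives 1 + 2 \<alpha> > 0, so
  \<open>cc 2\<close> = 2 + 2 \<alpha> exceeds 1, and being an integer it is at least 2.\<close>

lemma alpha_nonneg: "\<alpha> \<ge> 0"
proof -
  obtain y z where yz: "d y z = 2" using pair_at[of 2] D3 by auto
  obtain n :: nat where n: "cc 2 = real n" using card_c[OF yz] by metis
  have c2: "2 + 2 * \<alpha> = real n" using n by (simp add: cc_def)
  have "1 + 2 * \<alpha> > 0" using cc_ge_1[of 3] D3 by (simp add: cc_def)
  then have "real n > 1" using c2 by linarith
  then have "n \<ge> 2" by linarith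
  then show ?thesis using c2 by linarith
qed

lemma beta_gt: "\<beta> > \<alpha> * (real D - 1)"
  using bb_pos[of "D - 1"] D3 by (simp add: bb_def of_nat_diff)

section \<open>The eigenvalues and the meaning of tightness\<close>

definition ev :: "nat \<Rightarrow> real" where
  "ev n = (real D - real n) * (\<beta> - \<alpha> * real n) - real n"

lemma ev_Suc_less:
  assumes "n < D"
  shows "ev (Suc n) < ev n"
proof -
  have "ev n - ev (Suc n) = \<beta> - \<alpha> * (real D - 1) + 2 * (\<alpha> * (real D - 1 - real n)) + 1"
    by (simp add: ev_def algebra_simps)
  moreover have "\<alpha> * (real D - 1 - real n) \<ge> 0"
    using alpha_nonneg assms by (intro mult_nonneg_nonneg) auto
  ultimately show ?thesis using beta_gt by linarith
qed

lemma ev_less: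
  assumes "m < n" "n \<le> D"
  shows "ev n < ev m"
  using assms
proof (induction n)
  case (Suc n)
  then show ?case using ev_Suc_less[of n] by (cases "m = n") auto
qed simp

text \<open>On functions of the distance to a base vertex, the adjacency matrix is bidiagonal in the basis
  of binomial coefficients.\<close>

lemma nbr_binomial:
  "(\<Sum>w | E z w. real (d y w choose n)) =
     ev n * real (d y z choose n) + (if n = 0 then 0 else bb (n - 1) * real (d y z choose (n - 1)))"
proof (cases n)
  case 0
  then show ?thesis using card_nbrs[of z] by (simp add: ev_def bb_def)
next
  case (Suc m)
  define i where "i = d y z"
  define P Q where "P = real (i choose m)" and "Q = real (i choose Suc m)"
  have PQ: "(real i - real m) * P = (real m + 1) * Q"
  proof (cases "m \<le> i")
    case True
    have "Suc m * (i choose Suc m) = (i - m) * (i choose m)"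
      using binomial_absorb_comp[of i m] binomial_absorption[of m i] by (cases i) (auto simp: algebra_simps)
    then have "real (Suc m) * Q = real (i - m) * P" unfolding P_def Q_def by (metis of_nat_mult)
    then show ?thesis using True by (simp add: of_nat_diff algebra_simps)
  qed (simp add: P_def Q_def binomial_eq_0)
  \<comment> \<open>Pascal's rule lowers the upper index, and absorption turns i * C(i-1, m) into
    (m+1) * C(i, m+1).\<close>
  have down: "cc i * real (i - 1 choose Suc m) = cc i * Q - (1 + \<alpha> * (real i - 1)) * ((real m + 1) * Q)"
  proof (cases i)
    case (Suc j)
    have "Suc j * (j choose m) = Suc m * (Suc j choose Suc m)"
      using Suc_times_binomial[of m j] by simp
    then have "real (Suc j) * real (j choose m) = real (Suc m) * Q"
      unfolding Q_def Suc by (metis of_nat_mult)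
    then have "real i * real (j choose m) = (real m + 1) * Q" using Suc by simp
    moreover have "Q = real (j choose m) + real (j choose Suc m)" unfolding Q_def Suc by simp
    ultimately show ?thesis using Suc unfolding cc_def by simp (smt (verit, ccfv_SIG) distrib_left mult.assoc mult.commute)
  qed (simp add: cc_def Q_def)
  have up: "real (i + 1 choose Suc m) = P + Q" unfolding P_def Q_def by simp
  have "(\<Sum>w | E z w. real (d y w choose n)) =
      cc i * real (i - 1 choose Suc m) + aa i * Q + bb i * (P + Q)"
    using nbr_sum[of y z i "\<lambda>j. real (j choose n)"] i_def Suc up Q_def by simp
  also have "\<dots> = bb 0 * Q + bb i * P - (1 + \<alpha> * (real i - 1)) * ((real m + 1) * Q)"
    unfolding down aa_def by (simp add: algebra_simps)
  \<comment> \<open>The difference \<open>bb i - bb m\<close> is divisible by i - m, so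
    \<open>PQ\<close> turns it into a multiple of \<open>Q\<close>; only \<open>bb m\<close> remains
    as coefficient of \<open>P\<close>.\<close>
  also have "bb i * P = bb m * P + ((real i - real m) * P) * (\<alpha> * (real i + real m) - \<beta> - \<alpha> * real D)"
    unfolding bb_def by (simp add: algebra_simps)
  also have "bb 0 * Q + (bb m * P + ((real i - real m) * P) * (\<alpha> * (real i + real m) - \<beta> - \<alpha> * real D))
      - (1 + \<alpha> * (real i - 1)) * ((real m + 1) * Q) = ev n * Q + bb m * P"
    unfolding PQ unfolding bb_def ev_def Suc by (simp add: algebra_simps)
  finally show ?thesis unfolding Q_def P_def i_def Suc by simp
qed

lemma adj_mult: "(adj_matrix E *v v) $ z = (\<Sum>w | E z w. v $ w)"
  by (simp add: matrix_vector_mult_def adj_matrix_def if_distrib[where f="\<lambda>t. t * _"] sum.If_cases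
      cong: if_cong)

lemma eigenvalue_iff:
  "\<theta> \<in> graph_eigenvalues E \<longleftrightarrow>
     (\<exists>v. v \<noteq> 0 \<and> (\<forall>z. (\<Sum>w | E z w. v $ w) = complex_of_real \<theta> * v $ z))"
  unfolding graph_eigenvalues_def by (simp add: Finite_Cartesian_Product.vec_eq_iff adj_mult)

text \<open>An eigenvector is built in the binomial basis: bidiagonality gives a first-order
  recurrence for the coefficients \<open>t j\<close>. The resulting function of the distance to
  \<open>y\<close> is nonzero because its value at \<open>y\<close> is 1.\<close>

lemma ev_is_eigenvalue:
  assumes "n \<le> D"
  shows "ev n \<in> graph_eigenvalues E"
proof -
  obtain y :: 'a where True by simp
  define t where "t j = (\<Prod>l<j. (ev n - ev l) / bb l)" for j
  define H where "H i = (\<Sum>j\<le>D. t j * real (i choose j))" for i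
  have tS: "t (Suc j) * bb j = t j * (ev n - ev j)" if "j < D" for j
    using bb_pos[OF that] by (simp add: t_def)
  \<comment> \<open>The recurrence closes up at \<open>D\<close>: for n < D the product
    \<open>t D\<close> contains the zero factor with l = n.\<close>
  have tD: "t D * (ev n - ev D) = 0"
    using assms by (cases "n = D") (auto simp: t_def)
  have H: "(\<Sum>w | E z w. H (d y w)) = ev n * H (d y z)" for z
  proof -
    let ?C = "\<lambda>j. real (d y z choose j)"
    have "(\<Sum>w | E z w. H (d y w)) = (\<Sum>j\<le>D. t j * (\<Sum>w | E z w. real (d y w choose j)))"
      unfolding H_def by (subst sum.swap) (simp add: sum_distrib_left)
    also have "\<dots> = (\<Sum>j\<le>D. t j * ev j * ?C j) +
        (\<Sum>j\<le>D. if j = 0 then 0 else t j * bb (j - 1) * ?C (j - 1))"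
      unfolding nbr_binomial sum.distrib[symmetric] by (rule sum.cong) (auto simp: algebra_simps)
    also have "(\<Sum>j\<le>D. if j = 0 then 0 else t j * bb (j - 1) * ?C (j - 1)) =
        (\<Sum>j<D. t (Suc j) * bb j * ?C j)"
      using D3 by (cases D) (simp_all add: sum.atMost_Suc_shift lessThan_Suc_atMost del: sum.atMost_Suc)
    also have "\<dots> = (\<Sum>j<D. t j * (ev n - ev j) * ?C j)"
      using tS by (intro sum.cong) auto
    also have "\<dots> = (\<Sum>j\<le>D. t j * (ev n - ev j) * ?C j)"
      using tD by (simp add: lessThan_Suc_atMost[symmetric])
    also have "(\<Sum>j\<le>D. t j * ev j * ?C j) + \<dots> = ev n * H (d y z)"
      unfolding H_def sum.distrib[symmetric] sum_distrib_left by (rule sum.cong) (auto simp: algebra_simps)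
    finally show ?thesis .
  qed
  have "H 0 = (\<Sum>j\<le>D. if j = 0 then 1 else 0)"
    unfolding H_def by (rule sum.cong) (auto simp: t_def)
  then have H0: "H 0 = 1" by simp
  define v :: "complex^'a" where "v = (\<chi> z. complex_of_real (H (d y z)))"
  have "v $ y = 1" using H0 by (simp add: v_def)
  then have "v \<noteq> 0" by auto
  moreover have "(\<Sum>w | E z w. v $ w) = complex_of_real (ev n) * v $ z" for z
    using H[of z] unfolding v_def by (simp flip: of_real_sum of_real_mult)
  ultimately show ?thesis unfolding eigenvalue_iff by blast
qed

text \<open>Pairing an eigenvector with the binomial functions gives (\<theta> - ev n) V n = b(n-1)
  V(n-1), so every \<open>V n\<close> vanishes if \<theta> is none of the \<open>ev n\<close>. But
  the alternating sum of binomials is the indicator of \<open>y\<close>, so the \<open>V n\<close>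
  recover the nonzero entry at \<open>y\<close>.\<close>

lemma eigenvalue_is_ev:
  assumes "\<theta> \<in> graph_eigenvalues E"
  shows "\<exists>n\<le>D. \<theta> = ev n"
proof (rule ccontr)
  assume no: "\<not> (\<exists>n\<le>D. \<theta> = ev n)"
  obtain v where v: "v \<noteq> 0" "\<And>z. (\<Sum>w | E z w. v $ w) = complex_of_real \<theta> * v $ z"
    using assms unfolding eigenvalue_iff by blast
  obtain y where y: "v $ y \<noteq> 0" using v(1) by (auto simp: Finite_Cartesian_Product.vec_eq_iff)
  define V where "V n = (\<Sum>z\<in>UNIV. v $ z * of_nat (d y z choose n))" for n
  have step: "complex_of_real \<theta> * V n = complex_of_real (ev n) * V n
      + (if n = 0 then 0 else complex_of_real (bb (n - 1)) * V (n - 1))" for n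
  proof -
    have "complex_of_real \<theta> * V n = (\<Sum>z\<in>UNIV. (\<Sum>w | E z w. v $ w) * of_nat (d y z choose n))"
      unfolding V_def v(2) by (simp add: sum_distrib_left mult.assoc)
    also have "\<dots> = (\<Sum>z\<in>UNIV. \<Sum>w\<in>UNIV. if E z w then v $ w * of_nat (d y z choose n) else 0)"
      by (simp add: sum_distrib_right sum.If_cases)
    also have "\<dots> = (\<Sum>w\<in>UNIV. \<Sum>z\<in>UNIV. if E w z then v $ w * of_nat (d y z choose n) else 0)"
      by (subst sum.swap) (use E_sym in \<open>intro sum.cong if_cong; blast\<close>)
    also have "\<dots> = (\<Sum>w\<in>UNIV. v $ w * of_real (\<Sum>z | E w z. real (d y z choose n)))"
      by (simp add: sum_distrib_left sum.If_cases)
    also have "\<dots> = complex_of_real (ev n) * V n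
      + (if n = 0 then 0 else complex_of_real (bb (n - 1)) * V (n - 1))"
      unfolding nbr_binomial V_def
      by (auto simp: sum_distrib_left sum.distrib[symmetric] algebra_simps intro!: sum.cong)
    finally show ?thesis .
  qed
  have V0: "n \<le> D \<Longrightarrow> V n = 0" for n
  proof (induction n)
    case 0
    then show ?case using step[of 0] no by auto
  next
    case (Suc n)
    then show ?case using step[of "Suc n"] no by auto
  qed
  have "(\<Sum>n\<le>D. (-1) ^ n * V n) = (\<Sum>z\<in>UNIV. v $ z * (\<Sum>n\<le>D. (-1) ^ n * of_nat (d y z choose n)))"
    unfolding V_def sum_distrib_left by (subst sum.swap) (simp add: mult_ac)
  also have "\<dots> = (\<Sum>z\<in>UNIV. v $ z * (if z = y then 1 else 0))"
  proof (intro sum.cong refl arg_cong2[where f="(*)"])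
    fix z
    have "(\<Sum>n\<le>D. (-1) ^ n * complex_of_nat (d y z choose n)) = (\<Sum>n\<le>d y z. (-1) ^ n * of_nat (d y z choose n))"
      using d_le_D by (intro sum.mono_neutral_right) auto
    also have "\<dots> = (if z = y then 1 else 0)"
      using choose_alternating_sum[of "d y z", where ?'a=complex] d_eq_0[of y z]
      by (cases "z = y") (auto simp del: d_eq_0)
    finally show "(\<Sum>n\<le>D. (-1) ^ n * complex_of_nat (d y z choose n)) = (if z = y then 1 else 0)" .
  qed
  finally show False using V0 y by (simp add: mult_delta_right)
qed

lemma theta_ev:
  assumes "i \<le> D"
  shows "theta E i = ev i"
proof -
  have "graph_eigenvalues E = ev ` {0..D}"
    using ev_is_eigenvalue eigenvalue_is_ev by (fastforce simp: image_iff)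
  moreover have "sorted_wrt (<) (rev (map ev [0..<Suc D]))"
    unfolding sorted_wrt_rev sorted_wrt_map
    by (rule sorted_wrt_mono_rel[OF _ sorted_wrt_upt]) (auto intro: ev_less)
  moreover have "set (rev (map ev [0..<Suc D])) = ev ` {0..D}"
    by (simp add: atLeastLessThanSuc_atLeastAtMost del: upt_Suc)
  ultimately have "sorted_list_of_set (graph_eigenvalues E) = rev (map ev [0..<Suc D])"
    by (metis List.finite_set sorted_list_of_set.idem_if_sorted_distinct strict_sorted_iff)
  then show ?thesis using assms unfolding theta_def by (simp del: upt_Suc)
qed

text \<open>With A = a1 + 1 = \<beta> + \<gamma>, clearing denominators and cancelling
  \<open>bb 1\<close> and \<open>D\<close> leaves the factorised equation A * (\<gamma> - \<beta> +
  1) = 0, where A > 0.\<close>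

lemma tight_beta:
  assumes "tight_graph E"
  shows "\<beta> = 1 + \<alpha> * (real D - 1)"
proof -
  obtain y z where yz: "d y z = 1" using pair_at[of 1] D3 by auto
  have a1: "real (a_number E 1) = aa 1"
  proof -
    have "intersection_number E 1 1 1 = card (p_set E z y 1 1)"
      by (rule intersection_number_eq) (use dr yz d_sym in auto)
    moreover have "p_set E z y 1 1 = {w. E z w \<and> d y w = 1}"
      by (auto simp: p_set_def d_eq_1[symmetric])
    ultimately show ?thesis using card_a[OF yz] by (simp add: a_number_def)
  qed
  have b: "real (b_number E 0) = bb 0" "real (b_number E 1) = bb 1"
    using classical D3 by (auto simp: classical_parameters_q1_def bb_def)
  define \<gamma> where "\<gamma> = \<alpha> * (real D - 1)"
  define A where "A = \<beta> + \<gamma>"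
  have g0: "\<gamma> \<ge> 0" using alpha_nonneg D3 by (simp add: \<gamma>_def)
  have A0: "A > 0" using beta_gt g0 by (simp add: A_def \<gamma>_def)
  have aA: "aa 1 + 1 = A"
    by (simp add: aa_def bb_def cc_def A_def \<gamma>_def algebra_simps)
  have eq: "(ev 1 + bb 0 / A) * (ev D + bb 0 / A) = - (bb 0 * aa 1 * bb 1 / A\<^sup>2)"
    using assms D3 aA theta_ev[of 1] theta_ev[of D] a1 b diameter_D
    by (simp add: tight_graph_def Let_def)
  have "((ev 1 + bb 0 / A) * A) * ((ev D + bb 0 / A) * A) = (ev 1 + bb 0 / A) * (ev D + bb 0 / A) * A\<^sup>2"
    by (simp add: power2_eq_square)
  also have "\<dots> = - (bb 0 * aa 1 * bb 1)" unfolding eq using A0 by simp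
  finally have "(ev 1 * A + bb 0) * (ev D * A + bb 0) = - (bb 0 * aa 1 * bb 1)"
    using A0 by (simp add: algebra_simps)
  moreover have "ev 1 * A + bb 0 = bb 1 * (A + 1)"
    by (simp add: ev_def bb_def A_def \<gamma>_def algebra_simps)
  moreover have "ev D * A + bb 0 = - (real D * \<gamma>)"
    by (simp add: ev_def bb_def A_def \<gamma>_def algebra_simps)
  moreover have "bb 0 = real D * \<beta>" by (simp add: bb_def)
  moreover have "aa 1 = A - 1" using aA by simp
  ultimately have "bb 1 * (A + 1) * - (real D * \<gamma>) = - (real D * \<beta> * (A - 1) * bb 1)"
    by metis
  then have "(bb 1 * real D) * ((A + 1) * \<gamma>) = (bb 1 * real D) * (\<beta> * (A - 1))"
    by (simp only: mult_ac mult_minus_left mult_minus_right neg_equal_iff_equal)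
  moreover have "bb 1 * real D \<noteq> 0" using bb_pos[of 1] D3 by auto
  ultimately have "(A + 1) * \<gamma> = \<beta> * (A - 1)" by simp
  then have "A * (\<gamma> - \<beta> + 1) = 0" by (simp add: A_def algebra_simps)
  then show ?thesis using A0 by (simp add: \<gamma>_def)
qed

end

section \<open>Sphere sizes and cosine sequences\<close>

context classical_q1
begin

text \<open>Double counting of the edges between two vertex sets.\<close>

lemma nbr_sum_sphere_swap:
  fixes g :: "'a \<Rightarrow> 'a \<Rightarrow> 'b::comm_monoid_add"
  shows "(\<Sum>z | P z. \<Sum>w | E z w \<and> Q w. g z w) = (\<Sum>w | Q w. \<Sum>z | E w z \<and> P z. g z w)"
proof -
  have "(\<Sum>z | P z. \<Sum>w | E z w \<and> Q w. g z w) =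
      (\<Sum>z\<in>{z. P z}. \<Sum>w\<in>{w \<in> {w. Q w}. E z w}. g z w)"
    by (intro sum.cong) auto
  also have "\<dots> = (\<Sum>w\<in>{w. Q w}. \<Sum>z\<in>{z \<in> {z. P z}. E z w}. g z w)"
    by (rule sum.swap_restrict) auto
  also have "\<dots> = (\<Sum>w | Q w. \<Sum>z | E w z \<and> P z. g z w)"
    by (intro sum.cong) (auto intro: E_sym)
  finally show ?thesis .
qed

lemma sphere_card_step:
  "real (card {w. d y w = i}) * bb i = real (card {w. d y w = i + 1}) * cc (i + 1)"
proof -
  have "real (card {w. d y w = i}) * bb i = (\<Sum>z | d y z = i. bb i)" by simp
  also have "\<dots> = (\<Sum>z | d y z = i. \<Sum>w | E z w \<and> d y w = i + 1. 1)"
    by (rule sum.cong[OF refl]) (simp only: sum_constant mem_Collect_eq card_b mult_1_right)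
  also have "\<dots> = (\<Sum>w | d y w = i + 1. \<Sum>z | E w z \<and> d y z = i. 1)"
    by (rule nbr_sum_sphere_swap)
  also have "\<dots> = (\<Sum>w | d y w = i + 1. cc (i + 1))"
    by (rule sum.cong[OF refl]) (simp only: sum_constant mem_Collect_eq card_c[of y _ "i + 1", unfolded add_right_cancel] mult_1_right)
  also have "\<dots> = real (card {w. d y w = i + 1}) * cc (i + 1)" by simp
  finally show ?thesis .
qed

lemma sphere_card_prod:
  "real (card {w. d y w = i}) * (\<Prod>j<i. cc (Suc j)) = (\<Prod>j<i. bb j)"
proof (induction i)
  case 0
  then show ?case by simp
next
  case (Suc i)
  have "real (card {w. d y w = Suc i}) * (\<Prod>j<Suc i. cc (Suc j)) =
      (real (card {w. d y w = i + 1}) * cc (i + 1)) * (\<Prod>j<i. cc (Suc j))" by simp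
  also have "\<dots> = (real (card {w. d y w = i}) * bb i) * (\<Prod>j<i. cc (Suc j))"
    by (rule arg_cong[where f="\<lambda>t. t * _"], rule sphere_card_step[symmetric])
  also have "\<dots> = (real (card {w. d y w = i}) * (\<Prod>j<i. cc (Suc j))) * bb i"
    by (rule mult.assoc[THEN trans], subst mult.commute[of "bb i"], rule mult.assoc[symmetric])
  also have "\<dots> = (\<Prod>j<i. bb j) * bb i" by (rule arg_cong[OF Suc])
  finally show ?case by simp
qed

text \<open>The recurrence satisfied by the cosine sequence of an eigenvalue. The values outside
  0..D that it mentions carry the coefficients \<open>cc 0 = 0\<close> and
  \<open>bb D = 0\<close>.\<close>

definition cosine_rec :: "real \<Rightarrow> (nat \<Rightarrow> real) \<Rightarrow> bool" where
  "cosine_rec \<theta> \<phi> \<longleftrightarrow> (\<forall>i\<le>D. cc i * \<phi> (i - 1) + aa i * \<phi> i + bb i * \<phi> (i + 1) = \<theta> * \<phi> i)"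

text \<open>Since \<open>bb j > 0\<close> for j < D, each equation determines the next value; a
  solution is therefore fixed by its value at 0.\<close>

lemma cosine_rec_zero:
  assumes "cosine_rec \<theta> \<phi>" "\<phi> 0 = 0" "i \<le> D"
  shows "\<phi> i = 0"
  using assms(3)
proof (induction i rule: less_induct)
  case (less i)
  show ?case
  proof (cases i)
    case (Suc j)
    have "cc j * \<phi> (j - 1) + aa j * \<phi> j + bb j * \<phi> (j + 1) = \<theta> * \<phi> j"
      using assms(1) Suc less.prems by (simp add: cosine_rec_def)
    moreover have "\<phi> j = 0" "\<phi> (j - 1) = 0" using less Suc by auto
    ultimately show ?thesis using bb_pos[of j] Suc less.prems by simp
  qed (use assms(2) in simp)
qed

lemma sum_two_distances:
  "(\<Sum>w\<in>UNIV. g (d y w) (d z w)) = (\<Sum>i\<le>D. \<Sum>j\<le>D. real (card (p_set E y z i j)) * g i j)"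
proof -
  have "(\<Sum>w\<in>UNIV. g (d y w) (d z w)) =
      (\<Sum>i\<le>D. \<Sum>w | w \<in> UNIV \<and> d y w = i. g (d y w) (d z w))"
    by (rule sum.group[symmetric]) (use d_le_D in auto)
  also have "\<dots> = (\<Sum>i\<le>D. \<Sum>j\<le>D. \<Sum>w | w \<in> {w \<in> UNIV. d y w = i} \<and> d z w = j. g (d y w) (d z w))"
    by (rule sum.cong[OF refl], rule sum.group[symmetric]) (use d_le_D in auto)
  also have "\<dots> = (\<Sum>i\<le>D. \<Sum>j\<le>D. real (card (p_set E y z i j)) * g i j)"
    by (intro sum.cong refl) (simp add: p_set_def)
  finally show ?thesis .
qed

text \<open>The solution space of the three-term recurrence is one-dimensional and the Bose--Mesner algebra
  is closed under multiplication, so the matrix of a cosine sequence is a multiple of an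
  idempotent.\<close>

lemma cosine_rec_idempotent:
  assumes rec: "cosine_rec \<theta> \<sigma>" and s0: "\<sigma> 0 = 1"
  obtains \<kappa> where "\<And>y z. (\<Sum>w\<in>UNIV. \<sigma> (d y w) * \<sigma> (d z w)) = \<kappa> * \<sigma> (d y z)"
proof -
  define F where "F y z = (\<Sum>w\<in>UNIV. \<sigma> (d y w) * \<sigma> (d z w))" for y z
  have Fd: "F y z = F y' z'" if "d y z = d y' z'" for y z y' z'
  proof -
    have "card (p_set E y z i j) = card (p_set E y' z' i j)" for i j
      using dr that unfolding distance_regular_def by blast
    then show ?thesis unfolding F_def sum_two_distances[of "\<lambda>i j. \<sigma> i * \<sigma> j"] by simp
  qed
  \<comment> \<open>\<open>F\<close> depends on the distance only, so any pair at distance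
    \<open>i\<close> may represent it; at unattained distances the value is arbitrary.\<close>
  define \<phi> where "\<phi> i = (let q = (SOME q. d (fst q) (snd q) = i) in F (fst q) (snd q))" for i
  have F\<phi>: "F y z = \<phi> (d y z)" for y z
  proof -
    let ?q = "SOME q. d (fst q) (snd q) = d y z"
    have "d (fst ?q) (snd ?q) = d y z" by (rule someI[of _ "(y, z)"]) simp
    then show ?thesis unfolding \<phi>_def Let_def by (intro Fd) simp
  qed
  \<comment> \<open>Each row of \<open>F\<close> combines the eigenvectors w |-> \<sigma> (d u w),
    hence is an eigenvector itself.\<close>
  have AF: "(\<Sum>w | E z w. F y w) = \<theta> * F y z" for y z
  proof -
    have "(\<Sum>w | E z w. F y w) = (\<Sum>u\<in>UNIV. \<sigma> (d y u) * (\<Sum>w | E z w. \<sigma> (d u w)))"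
      unfolding F_def sum_distrib_left by (subst sum.swap) (simp add: d_sym)
    also have "\<dots> = (\<Sum>u\<in>UNIV. \<sigma> (d y u) * (\<theta> * \<sigma> (d u z)))"
    proof (intro sum.cong refl arg_cong2[where f="(*)"])
      fix u
      show "(\<Sum>w | E z w. \<sigma> (d u w)) = \<theta> * \<sigma> (d u z)"
        unfolding nbr_sum[OF refl] using rec d_le_D[of u z] by (simp add: cosine_rec_def)
    qed
    finally show ?thesis unfolding F_def sum_distrib_left by (simp add: d_sym mult_ac)
  qed
  have rec\<phi>: "cosine_rec \<theta> \<phi>"
    unfolding cosine_rec_def
  proof (intro allI impI)
    fix i assume "i \<le> D"
    then obtain y z where yz: "d y z = i" by (rule pair_at)
    show "cc i * \<phi> (i - 1) + aa i * \<phi> i + bb i * \<phi> (i + 1) = \<theta> * \<phi> i"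
      by (rule trans[OF nbr_sum[OF yz, of \<phi>, symmetric] AF[of y z, unfolded F\<phi> yz]])
  qed
  have "cosine_rec \<theta> (\<lambda>i. \<phi> i - \<phi> 0 * \<sigma> i)"
    unfolding cosine_rec_def
  proof (intro allI impI)
    fix i assume i: "i \<le> D"
    have "cc i * \<phi> (i - 1) + aa i * \<phi> i + bb i * \<phi> (i + 1) = \<theta> * \<phi> i"
      and "cc i * \<sigma> (i - 1) + aa i * \<sigma> i + bb i * \<sigma> (i + 1) = \<theta> * \<sigma> i"
      using rec\<phi> rec i by (auto simp: cosine_rec_def)
    moreover have "cc i * (\<phi> (i - 1) - \<phi> 0 * \<sigma> (i - 1)) + aa i * (\<phi> i - \<phi> 0 * \<sigma> i)
        + bb i * (\<phi> (i + 1) - \<phi> 0 * \<sigma> (i + 1)) =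
      (cc i * \<phi> (i - 1) + aa i * \<phi> i + bb i * \<phi> (i + 1))
        - \<phi> 0 * (cc i * \<sigma> (i - 1) + aa i * \<sigma> i + bb i * \<sigma> (i + 1))"
      by (simp only: algebra_simps)
    ultimately show "cc i * (\<phi> (i - 1) - \<phi> 0 * \<sigma> (i - 1)) + aa i * (\<phi> i - \<phi> 0 * \<sigma> i)
        + bb i * (\<phi> (i + 1) - \<phi> 0 * \<sigma> (i + 1)) = \<theta> * (\<phi> i - \<phi> 0 * \<sigma> i)"
      by (simp only: algebra_simps)
  qed
  then have zero: "\<phi> i - \<phi> 0 * \<sigma> i = 0" if "i \<le> D" for i
    by (rule cosine_rec_zero[OF _ _ that]) (simp_all add: s0)
  have "F y z = \<phi> 0 * \<sigma> (d y z)" for y z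
    using zero[OF d_le_D[of y z]] F\<phi>[of y z] by linarith
  then show thesis using that unfolding F_def by blast
qed

text \<open>Squared Frobenius norm of the product of two such matrices with a diagonal matrix in between.\<close>

lemma idempotent_diag_norm:
  fixes B :: "'a \<Rightarrow> real"
  assumes "\<And>y z. (\<Sum>w\<in>UNIV. \<sigma> (d y w) * \<sigma> (d z w)) = \<kappa> * \<sigma> (d y z)"
    and "\<And>y z. (\<Sum>w\<in>UNIV. \<tau> (d y w) * \<tau> (d z w)) = \<mu> * \<tau> (d y z)"
  shows "(\<Sum>y\<in>UNIV. \<Sum>z\<in>UNIV. (\<Sum>w\<in>UNIV. B w * (\<sigma> (d w y) * \<tau> (d w z)))\<^sup>2) =
    \<kappa> * \<mu> * (\<Sum>w\<in>UNIV. B w * (\<Sum>u\<in>UNIV. B u * (\<sigma> (d w u) * \<tau> (d w u))))"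
    (is "?L = ?R")
proof -
  have "?L = (\<Sum>y\<in>UNIV. \<Sum>z\<in>UNIV. \<Sum>w\<in>UNIV. \<Sum>u\<in>UNIV.
      (B w * B u) * (\<sigma> (d w y) * \<sigma> (d u y)) * (\<tau> (d w z) * \<tau> (d u z)))"
    by (simp add: power2_eq_square sum_product mult_ac)
  also have "\<dots> = (\<Sum>y\<in>UNIV. \<Sum>w\<in>UNIV. \<Sum>z\<in>UNIV. \<Sum>u\<in>UNIV.
      (B w * B u) * (\<sigma> (d w y) * \<sigma> (d u y)) * (\<tau> (d w z) * \<tau> (d u z)))"
    by (rule sum.cong[OF refl], rule sum.swap)
  also have "\<dots> = (\<Sum>w\<in>UNIV. \<Sum>y\<in>UNIV. \<Sum>u\<in>UNIV. \<Sum>z\<in>UNIV.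
      (B w * B u) * (\<sigma> (d w y) * \<sigma> (d u y)) * (\<tau> (d w z) * \<tau> (d u z)))"
    by (subst sum.swap) (rule sum.cong[OF refl], rule sum.cong[OF refl], rule sum.swap)
  also have "\<dots> = (\<Sum>w\<in>UNIV. \<Sum>u\<in>UNIV. \<Sum>y\<in>UNIV. \<Sum>z\<in>UNIV.
      (B w * B u) * (\<sigma> (d w y) * \<sigma> (d u y)) * (\<tau> (d w z) * \<tau> (d u z)))"
    by (rule sum.cong[OF refl], rule sum.swap)
  also have "\<dots> = (\<Sum>w\<in>UNIV. \<Sum>u\<in>UNIV. (B w * B u) *
      ((\<Sum>y\<in>UNIV. \<sigma> (d w y) * \<sigma> (d u y)) * (\<Sum>z\<in>UNIV. \<tau> (d w z) * \<tau> (d u z))))"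
    by (simp only: sum_product) (simp add: sum_distrib_left mult_ac)
  also have "\<dots> = ?R"
    unfolding assms by (simp add: sum_distrib_left mult_ac)
  finally show ?thesis .
qed

end

section \<open>Local structure of tight graphs\<close>

locale tight_q1 = classical_q1 +
  assumes tight: "tight_graph E" and non_bipartite: "\<not> bipartite_graph E"
begin

lemma beta_eq: "\<beta> = 1 + \<alpha> * (real D - 1)"
  using tight by (rule tight_beta)

lemma bb_eq: "bb i = (real D - real i) * (1 + \<alpha> * (real D - 1 - real i))"
  unfolding bb_def by (simp add: beta_eq algebra_simps)

lemma bb_cc: "i \<le> D \<Longrightarrow> bb i = cc (D - i)"
  unfolding bb_eq cc_def by (simp add: of_nat_diff algebra_simps)

lemma aa_eq: "aa i = 2 * \<alpha> * real i * (real D - real i)"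
  unfolding aa_def bb_eq cc_def by (simp add: algebra_simps)

text \<open>For \<alpha> = 0 all \<open>aa i\<close> vanish, no edge joins vertices equidistant from
  \<open>y\<close>, and the parity of the distance to \<open>y\<close> is a bipartition.\<close>

lemma alpha_pos: "\<alpha> > 0"
proof (rule ccontr)
  assume "\<not> \<alpha> > 0"
  then have "\<alpha> = 0" using alpha_nonneg by simp
  then have a0: "aa i = 0" for i unfolding aa_eq by simp
  obtain y :: 'a where True by simp
  have ne: "d y w \<noteq> d y z" if "E z w" for z w
  proof
    assume "d y w = d y z"
    then have "w \<in> {w. E z w \<and> d y w = d y z}" using that by simp
    moreover have "{w. E z w \<and> d y w = d y z} = {}" using card_a[OF refl, of z y] a0 by simp
    ultimately show False by blast
  qed
  then have "even (d y z) \<longleftrightarrow> odd (d y w)" if "E z w" for z w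
    using d_step_cases[OF that, of y] ne[OF that] by presburger
  then have "bipartite_graph E"
    unfolding bipartite_graph_def by (intro exI[of _ "{z. even (d y z)}"]) auto
  then show False using non_bipartite by simp
qed

section \<open>Antipodes\<close>

lemma card_antipodes: "card {w. d y w = D} = 1"
proof -
  \<comment> \<open>The symmetry \<open>bb_cc\<close> makes the two products in
    \<open>sphere_card_prod\<close> equal for i = D.\<close>
  have "(\<Prod>j<D. bb j) = (\<Prod>j<D. cc (Suc (D - Suc j)))"
    by (intro prod.cong) (auto simp: bb_cc Suc_diff_Suc)
  also have "\<dots> = (\<Prod>j<D. cc (Suc j))" by (rule prod.nat_diff_reindex)
  finally have "real (card {w. d y w = D}) * (\<Prod>j<D. cc (Suc j)) = (\<Prod>j<D. cc (Suc j))"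
    using sphere_card_prod[of y D] by simp
  moreover have "0 < (\<Prod>j<D. cc (Suc j))"
  proof (rule prod_pos)
    fix j assume "j \<in> {..<D}"
    then show "cc (Suc j) > 0" using cc_ge_1[of "Suc j"] by simp
  qed
  ultimately have "real (card {w. d y w = D}) = 1" by (metis less_irrefl mult_cancel_right1)
  then show ?thesis by simp
qed

definition antipode :: "'a \<Rightarrow> 'a" where "antipode y = (THE w. d y w = D)"

lemma antipode_iff: "d y w = D \<longleftrightarrow> w = antipode y"
proof -
  obtain u where u: "{w. d y w = D} = {u}" using card_antipodes by (rule card_1_singletonE)
  then have "d y w = D \<longleftrightarrow> w = u" for w by blast
  then show ?thesis unfolding antipode_def by simp
qed

text \<open>As \<open>bb i > 0\<close> for i < D, every geodesic from \<open>y\<close> extends until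
  it reaches distance \<open>D\<close>, where it can only end at the antipode. So every vertex lies
  on a geodesic from \<open>y\<close> to its antipode.\<close>

lemma d_antipode: "d y z + d z (antipode y) = D"
proof (rule antisym)
  show "D \<le> d y z + d z (antipode y)"
    using d_triangle[of y "antipode y" z] antipode_iff[of y "antipode y"] by simp
  show "d y z + d z (antipode y) \<le> D"
  proof (induction "D - d y z" arbitrary: z)
    case 0
    then have "d y z = D" using d_le_D[of y z] by simp
    then show ?case using antipode_iff[of y z] by simp
  next
    case (Suc n)
    have "real (card {w. E z w \<and> d y w = d y z + 1}) > 0"
      unfolding card_b[OF refl] using bb_pos[of "d y z"] Suc.hyps(2) by simp
    then obtain w where w: "E z w" "d y w = d y z + 1" by (auto simp: card_gt_0_iff)
    have IH: "d y w + d w (antipode y) \<le> D"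
      using Suc.hyps(1)[of w] Suc.hyps(2) w(2) by simp
    have "d (antipode y) z \<le> d (antipode y) w + 1" by (rule d_step[OF E_sym[OF w(1)]])
    then show ?case using IH w(2) unfolding d_sym[of "antipode y"] by simp
  qed
qed

section \<open>The cosine sequences \<open>sig\<close> of \<open>ev 1\<close> and \<open>tau\<close>
  of \<open>ev D\<close>\<close>

definition sig :: "nat \<Rightarrow> real" where "sig i = 1 - 2 * real i / real D"
definition tau :: "nat \<Rightarrow> real" where
  "tau i = (\<Prod>j<i. - (1 + \<alpha> * real j) / (1 + \<alpha> * (real D - 1 - real j)))"

text \<open>\<open>sig\<close> is affine in \<open>i\<close>, so the recurrence reduces to the
  identity \<open>bb i - cc i = bb 0 * sig i\<close>.\<close>

lemma cosine_rec_sig: "cosine_rec (bb 0 * (1 - 2 / real D)) sig"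
  unfolding cosine_rec_def
proof (intro allI impI)
  fix i assume "i \<le> D"
  have D0: "real D \<noteq> 0" using D3 by simp
  have "sig (i - 1) = sig i + 2 / real D" if "i > 0"
  proof -
    have "real (i - 1) = real i - 1" using that by simp
    moreover have "1 - 2 * (x - 1) / real D = 1 - 2 * x / real D + 2 / real D" for x
      using D0 by (simp add: field_simps)
    ultimately show ?thesis unfolding sig_def by simp
  qed
  then have 1: "cc i * sig (i - 1) = cc i * (sig i + 2 / real D)"
    by (cases "i = 0") (simp_all add: cc_def)
  have 2: "sig (i + 1) = sig i - 2 / real D" using D0 by (simp add: sig_def field_simps)
  have 3: "bb i - cc i = bb 0 * sig i"
    using D0 unfolding bb_eq cc_def sig_def by (simp add: field_simps)
  have "cc i * sig (i - 1) + aa i * sig i + bb i * sig (i + 1) = bb 0 * sig i - (2 / real D) * (bb i - cc i)"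
    unfolding 1 2 aa_def by (simp add: algebra_simps)
  then show "cc i * sig (i - 1) + aa i * sig i + bb i * sig (i + 1) = bb 0 * (1 - 2 / real D) * sig i"
    unfolding 3 by (simp add: algebra_simps)
qed

lemma denominator_pos: "j < D \<Longrightarrow> 1 + \<alpha> * (real D - 1 - real j) > 0"
  using alpha_pos by (intro add_pos_nonneg mult_nonneg_nonneg) auto

lemma tau_Suc:
  assumes "j < D"
  shows "tau (Suc j) * (1 + \<alpha> * (real D - 1 - real j)) = - (1 + \<alpha> * real j) * tau j"
  using denominator_pos[OF assms] by (simp add: tau_def)

text \<open>The ratio of successive values turns both outer terms into multiples of
  \<open>tau i\<close>; the rest is a polynomial identity.\<close>

lemma cosine_rec_tau: "cosine_rec (- real D) tau"
  unfolding cosine_rec_def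
proof (intro allI impI)
  fix i assume i: "i \<le> D"
  have 1: "cc i * tau (i - 1) = - real i * (1 + \<alpha> * (real D - real i)) * tau i"
  proof (cases i)
    case (Suc j)
    then have "(1 + real j) * (tau (Suc j) * (1 + \<alpha> * (real D - 1 - real j))) =
        (1 + real j) * (- (1 + \<alpha> * real j) * tau j)"
      using tau_Suc[of j] i by simp
    then show ?thesis unfolding cc_def Suc by (simp add: algebra_simps)
  qed (simp add: cc_def)
  have 2: "bb i * tau (i + 1) = - (real D - real i) * (1 + \<alpha> * real i) * tau i"
  proof (cases "i = D")
    case False
    then have "bb i * tau (i + 1) = (real D - real i) * (tau (Suc i) * (1 + \<alpha> * (real D - 1 - real i)))"
      unfolding bb_eq by simp
    also have "tau (Suc i) * (1 + \<alpha> * (real D - 1 - real i)) = - (1 + \<alpha> * real i) * tau i"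
      using tau_Suc[of i] i False by simp
    finally show ?thesis by (simp add: algebra_simps)
  qed (simp add: bb_eq)
  show "cc i * tau (i - 1) + aa i * tau i + bb i * tau (i + 1) = - real D * tau i"
    unfolding 1 2 aa_eq by (simp add: algebra_simps)
qed

definition zeta :: real where "zeta = \<alpha> * (real D - 2)"

lemma zeta_pos: "zeta > 0"
  using alpha_pos D3 by (simp add: zeta_def)

lemma tau_1: "tau 1 * (1 + \<alpha> * (real D - 1)) = - 1"
  using tau_Suc[of 0] D3 by (simp add: tau_def)

lemma tau_2: "tau 2 * (1 + \<alpha> * (real D - 2)) = - (1 + \<alpha>) * tau 1"
proof -
  have "real D - 1 - real 1 = real D - 2" by simp
  then show ?thesis using tau_Suc[of 1] D3 by (simp add: numeral_2_eq_2)
qed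

text \<open>On vectors with sum zero on the neighbours of p, the matrix of \<open>tau\<close> acts
  as (tau 0 - tau 2) I + (tau 1 - tau 2) A', with A' the local adjacency matrix. The relation makes
  this a nonzero multiple of A' - \<open>zeta\<close> I.\<close>

lemma tau_relation: "tau 0 - tau 2 = - zeta * (tau 1 - tau 2)" "tau 1 - tau 2 \<noteq> 0"
proof -
  define p q where "p = 1 + \<alpha> * (real D - 1)" and "q = 1 + \<alpha> * (real D - 2)"
  have p: "p > 0" and q: "q > 0"
    using denominator_pos[of 0] denominator_pos[of 1] D3 by (auto simp: p_def q_def)
  have t1: "tau 1 = - 1 / p" using tau_1 p by (simp add: p_def field_simps)
  have t2: "tau 2 = (1 + \<alpha>) / (p * q)"
    using tau_2 q p unfolding t1 q_def[symmetric] by (simp add: field_simps)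
  have pq: "p * q - (1 + \<alpha>) = zeta * (q + 1 + \<alpha>)"
    unfolding p_def q_def zeta_def by (simp add: algebra_simps)
  have dif: "tau 1 - tau 2 = - (q + 1 + \<alpha>) / (p * q)"
    unfolding t1 t2 using p q by (simp add: field_simps)
  have "tau 0 - tau 2 = (p * q - (1 + \<alpha>)) / (p * q)"
    unfolding t2 using p q by (simp add: tau_def field_simps)
  then show "tau 0 - tau 2 = - zeta * (tau 1 - tau 2)"
    unfolding pq dif by (simp only: minus_mult_minus times_divide_eq_right)
  show "tau 1 - tau 2 \<noteq> 0" unfolding dif using p q alpha_pos by simp
qed

text \<open>This is the equality case of the fundamental bound: the vector with entry 1 on the neighbours
  of p and entry D - 2 at p makes the Frobenius norm of the product vanish.\<close>

lemma tight_local_product: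
  assumes "E p y" "E p z"
  shows "(\<Sum>w | E p w. sig (d w y) * tau (d w z)) = - (real D - 2) * sig 1 * tau 1"
proof -
  have s0: "sig 0 = 1" "tau 0 = 1" by (simp_all add: sig_def tau_def)
  obtain \<kappa> where k: "\<And>y z. (\<Sum>w\<in>UNIV. sig (d y w) * sig (d z w)) = \<kappa> * sig (d y z)"
    using cosine_rec_idempotent[OF cosine_rec_sig s0(1)] by blast
  obtain \<mu> where m: "\<And>y z. (\<Sum>w\<in>UNIV. tau (d y w) * tau (d z w)) = \<mu> * tau (d y z)"
    using cosine_rec_idempotent[OF cosine_rec_tau s0(2)] by blast
  define B where "B w = (if E p w then 1 else 0) + (if w = p then real D - 2 else 0)" for w
  have B: "(\<Sum>w\<in>UNIV. B w * g w) = (\<Sum>w | E p w. g w) + (real D - 2) * g p" for g :: "'a \<Rightarrow> real"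
  proof -
    have "(\<Sum>w\<in>UNIV. B w * g w) = (\<Sum>w\<in>UNIV. if E p w then g w else 0)
        + (\<Sum>w\<in>UNIV. if w = p then (real D - 2) * g w else 0)"
      unfolding sum.distrib[symmetric] B_def by (intro sum.cong) (auto simp: algebra_simps)
    then show ?thesis by (simp add: sum.If_cases)
  qed
  \<comment> \<open>The norm formula involves only the entrywise product of the two cosine
    sequences.\<close>
  define \<psi> where "\<psi> i = sig i * tau i" for i
  have in_p: "(\<Sum>u\<in>UNIV. B u * \<psi> (d p u)) = bb 0 * \<psi> 1 + (real D - 2)"
    unfolding B using nbr_sum[of p p 0 \<psi>] by (simp add: cc_def aa_def \<psi>_def s0)
  have in_w: "(\<Sum>u\<in>UNIV. B u * \<psi> (d w u)) = 1 + aa 1 * \<psi> 1 + bb 1 * \<psi> 2 + (real D - 2) * \<psi> 1"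
    if "E p w" for w
  proof -
    have "d w p = 1" using that E_sym d_eq_1 by blast
    then show ?thesis
      unfolding B using nbr_sum[of w p 1 \<psi>] by (simp add: cc_def \<psi>_def s0 numeral_2_eq_2)
  qed
  have "(\<Sum>w\<in>UNIV. B w * (\<Sum>u\<in>UNIV. B u * \<psi> (d w u))) =
      bb 0 * (1 + aa 1 * \<psi> 1 + bb 1 * \<psi> 2 + (real D - 2) * \<psi> 1)
      + (real D - 2) * (bb 0 * \<psi> 1 + (real D - 2))"
    unfolding B[of "\<lambda>w. \<Sum>u\<in>UNIV. B u * \<psi> (d w u)"] in_p using in_w card_nbrs[of p] by simp
  also have "\<dots> = 0"
  proof -
    have D0: "real D > 0" using D3 by simp
    have b0: "bb 0 = real D * (1 + \<alpha> * (real D - 1))" by (simp add: bb_eq)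
    have b1: "bb 1 = (real D - 1) * (1 + \<alpha> * (real D - 2))" by (simp add: bb_eq algebra_simps)
    \<comment> \<open>The factors \<open>bb 0\<close> and \<open>bb 1\<close> clear the denominators
      of \<open>tau 1\<close> and \<open>tau 2\<close>.\<close>
    have "a * x * t = - a" if "t * x = - 1" for a x t :: real
      using that by (simp add: mult.assoc mult.commute[of x t])
    then have "bb 0 * tau 1 = - real D" unfolding b0 using tau_1 by blast
    then have p1: "bb 0 * \<psi> 1 = - (real D - 2)"
      using D0 unfolding \<psi>_def sig_def by (simp add: field_simps)
    have "(a * x) * (b * y) * u = a * b * c" if "t * x = - 1" "u * y = - c * t" for a b c x y t u :: real
    proof -
      have "(a * x) * (b * y) * u = a * b * (x * (u * y))" by (simp only: mult_ac)
      also have "\<dots> = - (a * b * c * (t * x))" unfolding that(2) by simp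
      finally show ?thesis unfolding that(1) by simp
    qed
    then have "bb 0 * bb 1 * tau 2 = real D * (real D - 1) * (1 + \<alpha>)"
      unfolding b0 b1 using tau_1 tau_2 by blast
    moreover have "real D * sig 2 = real D - 4" using D0 by (simp add: sig_def field_simps)
    moreover have "x * (a * t) = c * b * e" if "x * t = y * b * e" "y * a = c" for a b c e x y t :: real
      unfolding that(2)[symmetric] mult.left_commute[of x a] that(1) by (simp only: mult_ac)
    ultimately have p2: "bb 0 * bb 1 * \<psi> 2 = (real D - 4) * (real D - 1) * (1 + \<alpha>)"
      unfolding \<psi>_def by blast
    have "bb 0 * (1 + aa 1 * \<psi> 1 + bb 1 * \<psi> 2 + (real D - 2) * \<psi> 1)
      + (real D - 2) * (bb 0 * \<psi> 1 + (real D - 2)) =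
      bb 0 + aa 1 * (bb 0 * \<psi> 1) + bb 0 * bb 1 * \<psi> 2 + 2 * (real D - 2) * (bb 0 * \<psi> 1) + (real D - 2)\<^sup>2"
      by (simp add: algebra_simps power2_eq_square)
    also have "\<dots> = 0"
      unfolding p1 p2 unfolding b0 aa_eq by (simp add: algebra_simps power2_eq_square)
    finally show ?thesis .
  qed
  finally have "(\<Sum>y\<in>UNIV. \<Sum>z\<in>UNIV. (\<Sum>w\<in>UNIV. B w * (sig (d w y) * tau (d w z)))\<^sup>2) = 0"
    unfolding idempotent_diag_norm[OF k m] \<psi>_def by simp
  \<comment> \<open>A vanishing sum of squares forces every entry to vanish; the contribution of p
    itself then gives the right-hand side.\<close>
  then have "\<forall>y. (\<Sum>z\<in>UNIV. (\<Sum>w\<in>UNIV. B w * (sig (d w y) * tau (d w z)))\<^sup>2) = 0"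
    by (subst (asm) sum_nonneg_eq_0_iff) (auto intro: sum_nonneg)
  then have "(\<Sum>w\<in>UNIV. B w * (sig (d w y) * tau (d w z)))\<^sup>2 = 0"
    by (subst (asm) sum_nonneg_eq_0_iff) auto
  then have "(\<Sum>w | E p w. sig (d w y) * tau (d w z)) + (real D - 2) * (sig (d p y) * tau (d p z)) = 0"
    unfolding B by simp
  moreover have "d p y = 1" "d p z = 1" using assms d_eq_1 by auto
  ultimately show ?thesis by (simp add: algebra_simps)
qed

section \<open>The adjacency operator of the local graph at p\<close>

definition loc :: "'a \<Rightarrow> ('a \<Rightarrow> complex) \<Rightarrow> 'a \<Rightarrow> complex" where
  "loc p v y = (\<Sum>w | E p w \<and> E y w. v w)"

lemma local_distance_cases:
  assumes "E p y" "E p w"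
  obtains "w = y" "d w y = 0" | "E y w" "w \<noteq> y" "d w y = 1" | "\<not> E y w" "w \<noteq> y" "d w y = 2"
proof -
  have "d w y \<le> 2"
    using d_step[OF assms(1), of w] assms(2) E_sym d_eq_1[of w p] by auto
  then consider "d w y = 0" | "d w y = 1" | "d w y = 2" by linarith
  then show thesis
  proof cases
    case 2
    then show ?thesis using that(2) d_eq_1[of w y] E_sym E_irrefl by metis
  next
    case 3
    then have "\<not> E y w" "w \<noteq> y" using d_eq_1[of w y] E_sym[of y w] by auto
    then show ?thesis using that(3) 3 by blast
  qed (use that(1) in auto)
qed

text \<open>Two neighbours of p are at distance at most 2, so a function of the distance acts on
  them as a combination of I, the local adjacency matrix and J.\<close>

lemma local_distance_sum:
  fixes \<phi> :: "nat \<Rightarrow> complex"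
  assumes "E p y"
  shows "(\<Sum>w | E p w. \<phi> (d w y) * v w) =
    (\<phi> 0 - \<phi> 2) * v y + (\<phi> 1 - \<phi> 2) * loc p v y + \<phi> 2 * (\<Sum>w | E p w. v w)"
proof -
  have "(\<Sum>w | E p w. \<phi> (d w y) * v w) = (\<Sum>w | E p w. (if w = y then (\<phi> 0 - \<phi> 2) * v w else 0)
      + (if E y w then (\<phi> 1 - \<phi> 2) * v w else 0) + \<phi> 2 * v w)"
  proof (rule sum.cong[OF refl])
    fix w assume "w \<in> {w. E p w}"
    then have pw: "E p w" by simp
    show "\<phi> (d w y) * v w = (if w = y then (\<phi> 0 - \<phi> 2) * v w else 0)
      + (if E y w then (\<phi> 1 - \<phi> 2) * v w else 0) + \<phi> 2 * v w"
      using E_irrefl by (cases rule: local_distance_cases[OF assms pw]) (auto simp: algebra_simps)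
  qed
  also have "\<dots> = (\<Sum>w | E p w. if w = y then (\<phi> 0 - \<phi> 2) * v w else 0)
      + (\<Sum>w | E p w. if E y w then (\<phi> 1 - \<phi> 2) * v w else 0) + (\<Sum>w | E p w. \<phi> 2 * v w)"
    by (simp add: sum.distrib)
  also have "(\<Sum>w | E p w. if w = y then (\<phi> 0 - \<phi> 2) * v w else 0) = (\<phi> 0 - \<phi> 2) * v y"
    using assms by simp
  also have "(\<Sum>w | E p w. if E y w then (\<phi> 1 - \<phi> 2) * v w else 0) = (\<phi> 1 - \<phi> 2) * loc p v y"
    unfolding loc_def sum_distrib_left by (simp add: sum.If_cases Int_def)
  finally show ?thesis by (simp add: sum_distrib_left)
qed

lemma card_common_1:
  assumes "E p w"
  shows "real (card {y. E p y \<and> E w y}) = aa 1"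
proof -
  have "d w p = 1" using assms E_sym d_eq_1 by blast
  moreover have "{y. E p y \<and> E w y} = {y. E p y \<and> d w y = 1}" using d_eq_1 by auto
  ultimately show ?thesis using card_a[of w p 1] by simp
qed

text \<open>The local graph is regular of valency a1. In particular \<open>loc\<close> preserves
  vectors with sum zero.\<close>

lemma sum_loc: "(\<Sum>y | E p y. loc p v y) = of_real (aa 1) * (\<Sum>y | E p y. v y)"
proof -
  have "(\<Sum>y | E p y. loc p v y) = (\<Sum>y | E p y. \<Sum>w | E y w \<and> E p w. v w)"
    unfolding loc_def by (simp add: conj_commute)
  also have "\<dots> = (\<Sum>w | E p w. \<Sum>y | E w y \<and> E p y. v w)" by (rule nbr_sum_sphere_swap)
  also have "\<dots> = (\<Sum>w | E p w. of_real (aa 1) * v w)"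
  proof (rule sum.cong[OF refl])
    fix w assume "w \<in> {w. E p w}"
    then have "real (card {y. E w y \<and> E p y}) = aa 1"
      using card_common_1[of p w] by (simp add: conj_commute)
    then have "complex_of_nat (card {y. E w y \<and> E p y}) = of_real (aa 1)"
      by (metis of_real_of_nat_eq)
    then show "(\<Sum>y | E w y \<and> E p y. v w) = of_real (aa 1) * v w" by simp
  qed
  finally show ?thesis by (simp add: sum_distrib_left)
qed

text \<open>The local eigenvalues other than the valency are -2 and \<open>zeta\<close>.\<close>

lemma loc_quadratic:
  assumes v: "(\<Sum>w | E p w. v w) = 0" and y: "E p y"
  shows "loc p (loc p v) y = of_real (zeta - 2) * loc p v y + of_real (2 * zeta) * v y"
proof -
  let ?c = complex_of_real
  \<comment> \<open>\<open>g\<close> is the image of \<open>v\<close> under the matrix of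
    \<open>tau\<close> on the neighbours of p; the matrix of \<open>sig\<close> is applied to it
    next.\<close>
  define g where "g w = ?c (tau 0 - tau 2) * v w + ?c (tau 1 - tau 2) * loc p v w" for w
  have g: "(\<Sum>z | E p z. ?c (tau (d w z)) * v z) = g w" if "E p w" for w
  proof -
    have "(\<Sum>z | E p z. ?c (tau (d w z)) * v z) = (\<Sum>z | E p z. ?c (tau (d z w)) * v z)"
      by (simp add: d_sym)
    then show ?thesis
      using local_distance_sum[OF that, of "\<lambda>i. ?c (tau i)" v] v by (simp add: g_def)
  qed
  have "(\<Sum>w | E p w. g w) = 0"
    unfolding g_def by (simp add: sum.distrib v sum_loc flip: sum_distrib_left)
  then have "(\<Sum>w | E p w. ?c (sig (d w y)) * g w) = ?c (sig 0 - sig 2) * g y + ?c (sig 1 - sig 2) * loc p g y"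
    using local_distance_sum[OF y, of "\<lambda>i. ?c (sig i)" g] by simp
  \<comment> \<open>By tightness the product of the two matrices has constant entries, hence kills
    vectors with sum zero.\<close>
  moreover have "(\<Sum>w | E p w. ?c (sig (d w y)) * g w) = 0"
  proof -
    have "(\<Sum>w | E p w. ?c (sig (d w y)) * g w) =
        (\<Sum>w | E p w. \<Sum>z | E p z. ?c (sig (d w y) * tau (d w z)) * v z)"
      by (intro sum.cong refl) (simp add: g[symmetric] sum_distrib_left mult.assoc)
    also have "\<dots> = (\<Sum>z | E p z. ?c (\<Sum>w | E p w. sig (d w y) * tau (d w z)) * v z)"
      by (subst sum.swap) (simp add: sum_distrib_right)
    also have "\<dots> = (\<Sum>z | E p z. ?c (- (real D - 2) * sig 1 * tau 1) * v z)"
      using tight_local_product[OF y] by (intro sum.cong) auto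
    also have "\<dots> = 0" by (simp add: v flip: sum_distrib_left)
    finally show ?thesis .
  qed
  moreover have "loc p g y = ?c (tau 0 - tau 2) * loc p v y + ?c (tau 1 - tau 2) * loc p (loc p v) y"
    unfolding g_def loc_def by (simp only: sum.distrib sum_distrib_left)
  moreover have "?c (sig 0 - sig 2) = 2 * ?c (2 / real D)" "?c (sig 1 - sig 2) = ?c (2 / real D)"
    by (simp_all add: sig_def)
  moreover have "?c (tau 0 - tau 2) = - ?c zeta * ?c (tau 1 - tau 2)"
    unfolding tau_relation(1) by simp
  \<comment> \<open>The \<open>sig\<close> factor is a multiple of A' + 2 I, the \<open>tau\<close>
    factor of A' - \<open>zeta\<close> I; this expands (A' + 2 I)(A' - \<open>zeta\<close> I) v =
    0.\<close>
  moreover have "s * t * (b - ((x - 2) * a + 2 * x * c)) = 0"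
    if "0 = 2 * s * (- x * t * c + t * a) + s * (- x * t * a + t * b)" for s t a b c x :: complex
  proof -
    have "s * t * (b - ((x - 2) * a + 2 * x * c)) = 2 * s * (- x * t * c + t * a) + s * (- x * t * a + t * b)"
      by (simp add: algebra_simps)
    then show ?thesis using that by simp
  qed
  ultimately have "?c (2 / real D) * ?c (tau 1 - tau 2) *
      (loc p (loc p v) y - ((?c zeta - 2) * loc p v y + 2 * ?c zeta * v y)) = 0"
    by (metis (no_types, lifting) g_def)
  moreover have "?c (2 / real D) * ?c (tau 1 - tau 2) \<noteq> 0"
    using tau_relation(2) D3 by (simp only: mult_eq_0_iff of_real_eq_0_iff) auto
  ultimately show ?thesis by simp
qed

end

section \<open>Raising and lowering maps at a vertex\<close>

context tight_q1
begin

text \<open>The raising matrix at \<open>p\<close> as an operator: values move one step away from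
  \<open>p\<close>, so the sum runs over neighbours nearer to \<open>p\<close>. \<open>dn\<close> is
  its transpose, the lowering matrix.\<close>

definition up :: "'a \<Rightarrow> ('a \<Rightarrow> complex) \<Rightarrow> 'a \<Rightarrow> complex" where
  "up p v y = (\<Sum>z | E y z \<and> d p z + 1 = d p y. v z)"

definition dn :: "'a \<Rightarrow> ('a \<Rightarrow> complex) \<Rightarrow> 'a \<Rightarrow> complex" where
  "dn p v y = (\<Sum>z | E y z \<and> d p z = d p y + 1. v z)"

definition level :: "'a \<Rightarrow> nat \<Rightarrow> ('a \<Rightarrow> complex) \<Rightarrow> bool" where
  "level p j v \<longleftrightarrow> (\<forall>y. d p y \<noteq> j \<longrightarrow> v y = 0)"

lemma level_up: "level p j v \<Longrightarrow> level p (j + 1) (up p v)"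
  unfolding level_def up_def by (auto intro!: sum.neutral)

lemma level_dn: "level p (j + 1) v \<Longrightarrow> level p j (dn p v)"
  unfolding level_def dn_def by (auto intro!: sum.neutral)

lemma level_up_power: "level p j v \<Longrightarrow> level p (j + n) ((up p ^^ n) v)"
  by (induction n) (use level_up in auto)

lemma up_zero: "up p (\<lambda>y. 0) = (\<lambda>y. 0)"
  by (simp add: up_def fun_eq_iff)

lemma up_power_zero: "(up p ^^ n) (\<lambda>y. 0) = (\<lambda>y. 0)"
  by (induction n) (simp_all add: up_zero)

lemma up_add: "up p (\<lambda>y. f y + g y) = (\<lambda>y. up p f y + up p g y)"
  by (simp add: up_def sum.distrib fun_eq_iff)

lemma up_scale: "up p (\<lambda>y. c * f y) = (\<lambda>y. c * up p f y)"
  by (simp add: up_def sum_distrib_left fun_eq_iff)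

lemma up_power_add: "(up p ^^ n) (\<lambda>y. f y + g y) = (\<lambda>y. (up p ^^ n) f y + (up p ^^ n) g y)"
  by (induction n) (simp_all add: up_add)

lemma up_power_scale: "(up p ^^ n) (\<lambda>y. c * f y) = (\<lambda>y. c * (up p ^^ n) f y)"
  by (induction n) (simp_all add: up_scale)

lemma up_power_add': "(up p ^^ m) ((up p ^^ n) v) = (up p ^^ (m + n)) v"
  by (simp add: funpow_add)

text \<open>The product counts the geodesics of length m ending at \<open>w\<close>: stepping back
  towards a vertex at distance j + 1 leaves \<open>cc (Suc j)\<close> choices.\<close>

lemma up_power_formula:
  assumes "d p w = m + 1"
  shows "(up p ^^ m) v w = of_real (\<Prod>j<m. cc (Suc j)) * (\<Sum>y | E p y \<and> d y w = m. v y)"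
  using assms
proof (induction m arbitrary: w)
  case 0
  then have "{y. E p y \<and> d y w = 0} = {w}" using d_eq_1[of p w] by auto
  then show ?case by simp
next
  case (Suc m)
  let ?g = "complex_of_real (\<Prod>j<m. cc (Suc j))"
  have "(up p ^^ Suc m) v w = (\<Sum>u | E w u \<and> d p u + 1 = d p w. (up p ^^ m) v u)"
    by (simp add: up_def)
  also have "\<dots> = (\<Sum>u | E w u \<and> d p u = m + 1. ?g * (\<Sum>y | E p y \<and> d y u = m. v y))"
    using Suc by (intro sum.cong) auto
  also have "\<dots> = ?g * (\<Sum>u | E w u \<and> d p u = m + 1. \<Sum>y | E p y. if d y u = m then v y else 0)"
    by (simp add: sum_distrib_left sum.If_cases Int_def)
  also have "(\<Sum>u | E w u \<and> d p u = m + 1. \<Sum>y | E p y. if d y u = m then v y else 0) =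
      (\<Sum>y | E p y. \<Sum>u | E w u \<and> d p u = m + 1. if d y u = m then v y else 0)"
    by (rule sum.swap)
  also have "\<dots> = (\<Sum>y | E p y. if d y w = Suc m then of_real (cc (Suc m)) * v y else 0)"
  proof (rule sum.cong[OF refl])
    fix y assume "y \<in> {y. E p y}"
    then have py: "E p y" by simp
    have near: "d p u \<le> d y u + 1" "d y u \<le> d p u + 1" for u
      using d_step_cases[OF py, of u] d_sym[of u p] d_sym[of u y] by auto
    have near_w: "d p w \<le> d p u + 1" "d y w \<le> d y u + 1" if "E w u" for u
      using d_step[OF E_sym[OF that]] by auto
    have "(\<Sum>u | E w u \<and> d p u = m + 1. if d y u = m then v y else 0) =
        (\<Sum>u | E w u \<and> d p u = m + 1 \<and> d y u = m. v y)"
      by (simp add: sum.If_cases Int_def conj_ac)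
    \<comment> \<open>A neighbour \<open>u\<close> of \<open>w\<close> at distance m from
      \<open>y\<close> is automatically at distance m + 1 from \<open>p\<close>, by the triangle
      inequality.\<close>
    also have "{u. E w u \<and> d p u = m + 1 \<and> d y u = m} = {u. E w u \<and> d y u = m}"
    proof -
      have "d p u = m + 1" if "E w u" "d y u = m" for u
        using near(1)[of u] near_w(1)[OF that(1)] that(2) Suc.prems by simp
      then show ?thesis by blast
    qed
    also have "(\<Sum>u | E w u \<and> d y u = m. v y) = (if d y w = Suc m then of_real (cc (Suc m)) * v y else 0)"
    proof (cases "d y w = Suc m")
      case True
      have "real (card {u. E w u \<and> d y u = m}) = cc (Suc m)" using card_c[OF True] by simp
      then have "complex_of_nat (card {u. E w u \<and> d y u = m}) = of_real (cc (Suc m))"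
        by (metis of_real_of_nat_eq)
      then show ?thesis using True by simp
    next
      case False
      have "{u. E w u \<and> d y u = m} = {}"
        using near_w(2) near(1)[of w] Suc.prems False by fastforce
      then have "(\<Sum>u | E w u \<and> d y u = m. v y) = 0" by (simp only: sum.empty)
      then show ?thesis using False by simp
    qed
    finally show "(\<Sum>u | E w u \<and> d p u = m + 1. if d y u = m then v y else 0) =
        (if d y w = Suc m then of_real (cc (Suc m)) * v y else 0)" .
  qed
  also have "\<dots> = of_real (cc (Suc m)) * (\<Sum>y | E p y \<and> d y w = Suc m. v y)"
    by (simp add: sum.If_cases Int_def sum_distrib_left)
  finally show ?case by (simp add: mult_ac)
qed

text \<open>Counts the walks y, z, w with z at distance 2 from \<open>p\<close>. The common
  neighbours of \<open>y\<close> and \<open>w\<close> are \<open>p\<close>, those adjacent to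
  \<open>p\<close> (counted by the square of \<open>loc\<close>), and the wanted ones.\<close>

lemma dn_up_local:
  assumes y: "E p y"
  shows "dn p (up p v) y = of_real (bb 0 - cc 2) * v y + of_real (aa 1 - cc 2) * loc p v y
    - loc p (loc p v) y + of_real (cc 2 - 1) * (\<Sum>w | E p w. v w)"
proof -
  have dp: "d p y = 1" using y d_eq_1 by blast
  \<comment> \<open>The number of common neighbours of two vertices at distance 0, 1 or 2; below, N
    - 1 discounts \<open>p\<close>.\<close>
  define N where "N i = (if i = 0 then bb 0 else if i = 1 then aa 1 else cc 2)" for i :: nat
  have count: "complex_of_nat (card {z. E z w \<and> E y z \<and> d p z = 2}) =
      of_real (N (d w y) - 1) - of_nat (card {z. E z w \<and> E p z \<and> E y z})" if w: "E p w" for w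
  proof -
    have fin: "finite S" for S :: "'a set" by simp
    have "{z. E y z \<and> d w z = 1} = insert p ({z. E z w \<and> E p z \<and> E y z} \<union> {z. E z w \<and> E y z \<and> d p z = 2})"
    proof (intro equalityI subsetI)
      fix z assume z: "z \<in> {z. E y z \<and> d w z = 1}"
      then have "E y z" "E z w" using d_eq_1 E_sym by auto
      moreover have "z = p \<or> E p z \<or> d p z = 2"
        using d_step_cases[OF \<open>E y z\<close>, of p] dp d_eq_0[of p z] d_eq_1[of p z] by auto
      ultimately show "z \<in> insert p ({z. E z w \<and> E p z \<and> E y z} \<union> {z. E z w \<and> E y z \<and> d p z = 2})"
        by blast
    qed (use y w E_sym d_eq_1 in auto)
    moreover have "p \<notin> {z. E z w \<and> E p z \<and> E y z} \<union> {z. E z w \<and> E y z \<and> d p z = 2}"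
      using E_irrefl by auto
    moreover have "{z. E z w \<and> E p z \<and> E y z} \<inter> {z. E z w \<and> E y z \<and> d p z = 2} = {}"
    proof -
      have "d p z \<noteq> 2" if "E p z" for z using d_eq_1[of p z] that by simp
      then show ?thesis by blast
    qed
    ultimately have "card {z. E y z \<and> d w z = 1} =
        1 + (card {z. E z w \<and> E p z \<and> E y z} + card {z. E z w \<and> E y z \<and> d p z = 2})"
      by (simp add: card_insert_disjoint card_Un_disjoint)
    moreover have "real (card {z. E y z \<and> d w z = 1}) = N (d w y)"
      using y w
    proof (cases rule: local_distance_cases)
      case 1
      then show ?thesis using card_b[of w y 0] by (simp add: N_def)
    next
      case 2
      then show ?thesis using card_a[of w y 1] by (simp add: N_def)
    next
      case 3
      then show ?thesis using card_c[of w y 2] by (simp add: N_def)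
    qed
    ultimately have "real (card {z. E z w \<and> E y z \<and> d p z = 2}) =
        N (d w y) - 1 - real (card {z. E z w \<and> E p z \<and> E y z})" by simp
    then have "complex_of_real (real (card {z. E z w \<and> E y z \<and> d p z = 2})) =
        of_real (N (d w y) - 1 - real (card {z. E z w \<and> E p z \<and> E y z}))" by simp
    then show ?thesis by simp
  qed
  have swap: "(\<Sum>z | Q z. \<Sum>w | E z w \<and> E p w. v w) = (\<Sum>w | E p w. of_nat (card {z. E z w \<and> Q z}) * v w)" for Q
  proof -
    have "(\<Sum>z | Q z. \<Sum>w | E z w \<and> E p w. v w) = (\<Sum>w | E p w. \<Sum>z | E w z \<and> Q z. v w)"
      by (rule nbr_sum_sphere_swap)
    moreover have "{z. E w z \<and> Q z} = {z. E z w \<and> Q z}" for w using E_sym by blast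
    ultimately show ?thesis by simp
  qed
  have "dn p (up p v) y = (\<Sum>z | E y z \<and> d p z = 2. \<Sum>w | E z w \<and> E p w. v w)"
    unfolding dn_def dp up_def
  proof (rule sum.cong)
    fix z assume "z \<in> {z. E y z \<and> d p z = 2}"
    then show "(\<Sum>w | E z w \<and> d p w + 1 = d p z. v w) = (\<Sum>w | E z w \<and> E p w. v w)"
      using d_eq_1[of p] by (intro sum.cong) auto
  qed auto
  also have "\<dots> = (\<Sum>w | E p w. of_nat (card {z. E z w \<and> E y z \<and> d p z = 2}) * v w)"
    by (rule swap)
  also have "\<dots> = (\<Sum>w | E p w. of_real (N (d w y) - 1) * v w)
      - (\<Sum>w | E p w. of_nat (card {z. E z w \<and> E p z \<and> E y z}) * v w)"
    unfolding sum_subtractf[symmetric] left_diff_distrib[symmetric]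
    by (rule sum.cong[OF refl]) (simp only: count mem_Collect_eq)
  also have "(\<Sum>w | E p w. of_nat (card {z. E z w \<and> E p z \<and> E y z}) * v w) = loc p (loc p v) y"
    unfolding swap[symmetric] loc_def by (simp add: conj_commute)
  also have "(\<Sum>w | E p w. complex_of_real (N (d w y) - 1) * v w) =
      of_real (bb 0 - cc 2) * v y + of_real (aa 1 - cc 2) * loc p v y + of_real (cc 2 - 1) * (\<Sum>w | E p w. v w)"
    using local_distance_sum[OF y, of "\<lambda>i. complex_of_real (N i - 1)" v] by (simp add: N_def)
  finally show ?thesis by simp
qed

text \<open>\<open>loc_quadratic\<close> eliminates the square of \<open>loc\<close>, leaving an
  affine polynomial in \<open>loc\<close> whose linear coefficient \<open>zeta\<close> is
  nonzero.\<close>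

lemma dn_up_trace_zero:
  assumes v: "(\<Sum>w | E p w. v w) = 0" and y: "E p y"
  shows "dn p (up p v) y = of_real (bb 0 - cc 2 - 2 * zeta) * v y + of_real zeta * loc p v y"
proof -
  have "aa 1 - cc 2 - (zeta - 2) = zeta"
    unfolding aa_eq cc_def zeta_def by (simp add: algebra_simps)
  then have e: "complex_of_real (aa 1 - cc 2) = of_real zeta + of_real (zeta - 2)"
    by (metis diff_eq_eq of_real_add)
  show ?thesis
    unfolding dn_up_local[OF y] loc_quadratic[OF v y] v e by (simp add: algebra_simps)
qed

text \<open>Differences of two adjacent and of two non-adjacent neighbours of p would give different
  scalars.\<close>

lemma dn_up_not_scalar:
  assumes scalar: "\<And>v y. \<lbrakk>level p 1 v; (\<Sum>w | E p w. v w) = 0; E p y\<rbrakk> \<Longrightarrow> dn p (up p v) y = \<xi> * v y"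
  shows False
proof -
  have "real (card {w. E p w}) > 0" unfolding card_nbrs using bb_pos[of 0] D3 by simp
  then obtain y where y: "E p y" by (auto simp: card_gt_0_iff)
  \<comment> \<open>The value that \<open>loc p v y\<close> must have when \<open>v y = 1\<close>
    and the map is the scalar \<xi>.\<close>
  define c where "c = (\<xi> - of_real (bb 0 - cc 2 - 2 * zeta)) / of_real zeta"
  have z0: "complex_of_real zeta \<noteq> 0" using zeta_pos by simp
  have key: "loc p (\<lambda>u. (if u = y then 1 else 0) - (if u = z then 1 else 0)) y = c" if z: "E p z" "z \<noteq> y" for z
  proof -
    let ?v = "\<lambda>u. (if u = y then 1 else 0) - (if u = z then 1 else (0::complex))"
    have "level p 1 ?v" using y z d_eq_1 by (auto simp: level_def)
    moreover have s: "(\<Sum>w | E p w. ?v w) = 0" using y z by (simp add: sum_subtractf)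
    ultimately have "dn p (up p ?v) y = \<xi> * ?v y" using y by (rule scalar)
    then have "of_real (bb 0 - cc 2 - 2 * zeta) * ?v y + of_real zeta * loc p ?v y = \<xi> * ?v y"
      unfolding dn_up_trace_zero[OF s y] .
    then show ?thesis using z z0 by (simp add: c_def field_simps)
  qed
  have loc_v: "loc p (\<lambda>u. (if u = y then 1 else 0) - (if u = z then 1 else 0)) y = (if E y z then - 1 else 0)"
    if "E p z" for z
    unfolding loc_def using that y E_irrefl by (simp add: sum_subtractf)
  have "aa 1 > 0" unfolding aa_eq using alpha_pos D3 by simp
  then have "real (card {z. E p z \<and> E y z}) > 0" unfolding card_common_1[OF y] .
  then obtain z where z: "E p z" "E y z" by (auto simp: card_gt_0_iff)
  then have "c = - 1" using key[of z] loc_v[of z] E_irrefl by auto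
  have "d y p = 1" using y E_sym d_eq_1 by blast
  then have "real (card {w. E p w \<and> d y w = 2}) > 0" using card_b[of y p 1] bb_pos[of 1] D3
    by (simp add: numeral_2_eq_2)
  then obtain u where u: "E p u" "d y u = 2" by (auto simp: card_gt_0_iff)
  then have "u \<noteq> y" by auto
  then have "c = 0" using u key[of u] loc_v[of u] d_eq_1[of y u] by auto
  then show False using \<open>c = - 1\<close> by simp
qed

text \<open>Evaluating the power at the antipode of a neighbour z sums \<open>v\<close> over the
  neighbours of \<open>p\<close> not adjacent or equal to z. If these sums vanish, \<open>v\<close>
  is a local eigenvector for -1, but the only possible eigenvalues are -2 and \<open>zeta\<close> >
  0.\<close>

lemma up_power_injective:
  assumes v: "(\<Sum>w | E p w. v w) = 0" and zero: "(up p ^^ (D - 2)) v = (\<lambda>y. 0)" and y: "E p y"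
  shows "v y = 0"
proof -
  have loc_v: "loc p v z = - v z" if z: "E p z" for z
  proof -
    let ?w = "antipode z"
    have "d p z = 1" using z d_eq_1 by blast
    then have "d p ?w = (D - 2) + 1"
      using d_antipode[of z p] d_sym[of z p] D3 by simp
    then have "of_real (\<Prod>j<D - 2. cc (Suc j)) * (\<Sum>u | E p u \<and> d u ?w = D - 2. v u) = 0"
      using up_power_formula[of p ?w "D - 2" v] zero by simp
    moreover have "(\<Prod>j<D - 2. cc (Suc j)) \<noteq> 0"
    proof -
      have "cc (Suc j) \<noteq> 0" if "j < D - 2" for j using cc_ge_1[of "Suc j"] that by force
      then show ?thesis by (simp add: prod_zero_iff)
    qed
    moreover have "d u ?w = D - 2 \<longleftrightarrow> d u z = 2" for u
      using d_antipode[of z u] d_sym[of z u] D3 d_le_D[of u z] by auto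
    ultimately have "(\<Sum>u | E p u \<and> d u z = 2. v u) = 0" by simp
    then have "(\<Sum>u | E p u. (if d u z = 2 then 1 else 0) * v u) = 0"
      by (simp add: sum.If_cases Int_def if_distrib[where f="\<lambda>t. t * _"] cong: if_cong)
    \<comment> \<open>With the indicator of distance 2, the coefficients of \<open>v z\<close> and
      \<open>loc p v z\<close> are both -1.\<close>
    then show ?thesis
      using local_distance_sum[OF z, of "\<lambda>i. if i = 2 then 1 else 0" v] v
      by (simp add: add_eq_0_iff)
  qed
  have "loc p (loc p v) y = (\<Sum>w | E p w \<and> E y w. - v w)"
    unfolding loc_def[of p "loc p v"] using loc_v by (intro sum.cong) auto
  also have "\<dots> = v y" using loc_v[OF y] by (simp add: loc_def sum_negf)
  finally have "v y = of_real (zeta - 2) * (- v y) + of_real (2 * zeta) * v y"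
    using loc_quadratic[OF v y] loc_v[OF y] by simp
  then have "of_real (zeta + 1) * v y = 0" by (simp add: algebra_simps)
  moreover have "complex_of_real (zeta + 1) \<noteq> 0" using zeta_pos by (simp only: of_real_eq_0_iff)
  ultimately show ?thesis by simp
qed

text \<open>The image lives on the single vertex \<open>p\<close>, where its value is the sum of
  \<open>v\<close>.\<close>

lemma dn_trace_zero:
  assumes "level p 1 v" and "(\<Sum>w | E p w. v w) = 0"
  shows "dn p v = (\<lambda>y. 0)"
proof
  fix y
  show "dn p v y = 0"
  proof (cases "y = p")
    case True
    then have "dn p v y = (\<Sum>w | E p w. v w)"
      unfolding dn_def using d_eq_1[of p] by (intro sum.cong) auto
    then show ?thesis using assms(2) by simp
  next
    case False
    then have "d p y \<noteq> 0" by simp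
    then have "level p 0 (dn p v) \<Longrightarrow> ?thesis" by (simp add: level_def)
    then show ?thesis using level_dn[of p 0 v] assms(1) by simp
  qed
qed

text \<open>Level \<open>D\<close> is the antipode of \<open>p\<close> alone, and all neighbours of
  \<open>p\<close> are at distance D - 1 from it, so the value there is a multiple of the sum of
  \<open>v\<close>.\<close>

lemma up_power_top:
  assumes "level p 1 v" and v: "(\<Sum>w | E p w. v w) = 0"
  shows "(up p ^^ (D - 1)) v = (\<lambda>y. 0)"
proof
  fix w
  show "(up p ^^ (D - 1)) v w = 0"
  proof (cases "d p w = D")
    case True
    then have w: "w = antipode p" using antipode_iff by simp
    have "d y w = D - 1" if "E p y" for y
      using d_antipode[of p y] d_eq_1[of p y] that w by simp
    then have "{y. E p y \<and> d y w = D - 1} = {y. E p y}" by auto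
    then show ?thesis using up_power_formula[of p w "D - 1" v] True D3 v by simp
  next
    case False
    then show ?thesis using level_up_power[OF assms(1), of "D - 1"] D3 by (simp add: level_def)
  qed
qed

end

section \<open>Uniform structures\<close>

text \<open>The principal block s..t is nonsingular, so zero boundary values make the system
  uniquely solvable. The point is that \<open>X\<close> is chosen before \<open>z\<close> and
  \<open>c\<close>: the solution is linear in \<open>c\<close>, with factors depending on
  \<open>U\<close> and \<open>f\<close> only.\<close>

lemma parameter_matrix_solution:
  assumes U: "parameter_matrix n U" and st: "1 \<le> s" "s \<le> t" "t \<le> n"
  obtains X where "\<And>z c i. \<lbrakk>z (s - 1) = 0; z (t + 1) = 0;
      \<And>i. i \<in> {s..t} \<Longrightarrow> e_minus U i * z (i - 1) + z i + e_plus n U i * z (i + 1) = f i * c;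
      i \<in> {s..t}\<rbrakk> \<Longrightarrow> z i = X i * c"
proof -
  define N where "N = t + 1 - s"
  define M where "M = Matrix.mat N N (\<lambda>(i, j). U (s + i) (s + j))"
  have M: "M \<in> carrier_mat N N" by (simp add: M_def)
  note U' = U[unfolded parameter_matrix_def]
  have diag: "\<forall>i\<in>{1..n}. U i i = 1" using U' by (rule conjunct1)
  have off_diag: "\<forall>i\<in>{1..n}. \<forall>j\<in>{1..n}. i + 1 < j \<or> j + 1 < i \<longrightarrow> U i j = 0"
    using U' by (rule conjunct1[OF conjunct2])
  have minors: "\<forall>s t. 1 \<le> s \<and> s \<le> t \<and> t \<le> n \<longrightarrow> Determinant.det
        (Matrix.mat (t + 1 - s) (t + 1 - s) (\<lambda>(i, j). U (s + i) (s + j))) \<noteq> 0"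
    using U' by (rule conjunct2[OF conjunct2[OF conjunct2]])
  have "Determinant.det M \<noteq> 0"
    using minors[rule_format, of s t] st unfolding M_def N_def by simp
  then have "M \<in> Units (ring_mat TYPE(complex) N ())" by (rule det_non_zero_imp_unit[OF M])
  then obtain B where B: "B \<in> carrier_mat N N" "B * M = 1\<^sub>m N"
    by (auto simp: Units_def ring_mat_def)
  define X where "X k = (\<Sum>j<N. B $$ (k - s, j) * f (s + j))" for k
  have solution: "z i = X i * c"
    if z0: "z (s - 1) = 0" "z (t + 1) = 0"
      and rows: "\<And>i. i \<in> {s..t} \<Longrightarrow> e_minus U i * z (i - 1) + z i + e_plus n U i * z (i + 1) = f i * c"
      and i: "i \<in> {s..t}" for z c i
  proof -
    have row: "(\<Sum>j\<in>{s..t}. U i j * z j) = f i * c" if i: "i \<in> {s..t}" for i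
    proof -
      have in_n: "i \<in> {1..n}" using i st by auto
      have "U i j * z j = (if j = i then z i else 0) + (if j = i - 1 then U i (i - 1) * z (i - 1) else 0)
          + (if j = i + 1 then U i (i + 1) * z (i + 1) else 0)" if j: "j \<in> {s..t}" for j
      proof -
        have "j \<in> {1..n}" using j st by auto
        then have e: "U i i = 1" "i + 1 < j \<or> j + 1 < i \<Longrightarrow> U i j = 0"
          using diag off_diag in_n by blast+
        consider "j = i" | "j + 1 = i" | "j = i + 1" | "i + 1 < j \<or> j + 1 < i" by linarith
        then show ?thesis
        proof cases
          case 1
          then show ?thesis using e(1) in_n by auto
        next
          case 2
          then show ?thesis by auto
        next
          case 3
          then show ?thesis by auto
        next
          case 4
          then have "j \<noteq> i" "j \<noteq> i - 1" "j \<noteq> i + 1" by auto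
          then show ?thesis using e(2)[OF 4] by simp
        qed
      qed
      then have "(\<Sum>j\<in>{s..t}. U i j * z j) = (\<Sum>j\<in>{s..t}. (if j = i then z i else 0)
          + (if j = i - 1 then U i (i - 1) * z (i - 1) else 0)
          + (if j = i + 1 then U i (i + 1) * z (i + 1) else 0))"
        by (rule sum.cong[OF refl])
      also have "\<dots> = z i + (if i - 1 \<in> {s..t} then U i (i - 1) * z (i - 1) else 0)
          + (if i + 1 \<in> {s..t} then U i (i + 1) * z (i + 1) else 0)"
        using i by (simp add: sum.distrib)
      \<comment> \<open>At the edge of the block the missing entry would multiply a boundary value
        of \<open>z\<close>, which is zero.\<close>
      also have "(if i - 1 \<in> {s..t} then U i (i - 1) * z (i - 1) else 0) = e_minus U i * z (i - 1)"
      proof (cases "i = s")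
        case True
        then show ?thesis using z0 by auto
      next
        case False
        then show ?thesis using i st by (auto simp: e_minus_def)
      qed
      also have "(if i + 1 \<in> {s..t} then U i (i + 1) * z (i + 1) else 0) = e_plus n U i * z (i + 1)"
      proof (cases "i = t")
        case True
        then show ?thesis using z0 by auto
      next
        case False
        then show ?thesis using i st by (auto simp: e_plus_def)
      qed
      finally show ?thesis using rows[OF i] by (simp add: add.commute)
    qed
    have shift: "(\<Sum>l<N. g (s + l)) = (\<Sum>j\<in>{s..t}. g j)" for g :: "nat \<Rightarrow> complex"
      by (rule sum.reindex_bij_witness[of _ "\<lambda>j. j - s" "\<lambda>l. s + l"]) (use st in \<open>auto simp: N_def\<close>)
    define k where "k = i - s"
    have k: "k < N" "i = s + k" using i st by (auto simp: k_def N_def)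
    have BM: "(\<Sum>j<N. B $$ (k, j) * M $$ (j, l)) = (if l = k then 1 else 0)" if "l < N" for l
    proof -
      have "(B * M) $$ (k, l) = (\<Sum>j<N. B $$ (k, j) * M $$ (j, l))"
        using B(1) M k(1) that by (simp add: scalar_prod_def atLeast0LessThan)
      then show ?thesis using B(2) k(1) that by (cases "l = k") auto
    qed
    have "z i = (\<Sum>l<N. (if l = k then 1 else 0) * z (s + l))"
      using k by (simp add: mult_delta_left)
    also have "\<dots> = (\<Sum>l<N. (\<Sum>j<N. B $$ (k, j) * M $$ (j, l)) * z (s + l))"
      using BM by (intro sum.cong) auto
    also have "\<dots> = (\<Sum>j<N. B $$ (k, j) * (\<Sum>l<N. M $$ (j, l) * z (s + l)))"
      unfolding sum_distrib_left sum_distrib_right by (subst sum.swap) (simp add: mult.assoc)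
    also have "\<dots> = (\<Sum>j<N. B $$ (k, j) * (f (s + j) * c))"
    proof (intro sum.cong refl arg_cong2[where f="(*)"])
      fix j assume "j \<in> {..<N}"
      then have j: "j < N" by simp
      have "(\<Sum>l<N. M $$ (j, l) * z (s + l)) = (\<Sum>l<N. U (s + j) (s + l) * z (s + l))"
        using j by (intro sum.cong) (auto simp: M_def)
      also have "\<dots> = (\<Sum>l\<in>{s..t}. U (s + j) l * z l)" by (rule shift)
      also have "\<dots> = f (s + j) * c" using j st by (intro row) (auto simp: N_def)
      finally show "(\<Sum>l<N. M $$ (j, l) * z (s + l)) = f (s + j) * c" .
    qed
    finally show ?thesis unfolding X_def k_def[symmetric] by (simp add: sum_distrib_right mult.assoc)
  qed
  show thesis by (rule that, rule solution)
qed

section \<open>Entries of the lowering and raising matrices\<close>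

lemma Estar_mult_left: "(Estar E x i ** M) $ y $ z = (if gdist E x y = i then M $ y $ z else 0)"
  by (cases "gdist E x y = i") (simp_all add: matrix_matrix_mult_def Estar_def mult_delta_left)

lemma Estar_mult_right: "(M ** Estar E x i) $ y $ z = (if gdist E x z = i then M $ y $ z else 0)"
  by (cases "gdist E x z = i") (simp_all add: matrix_matrix_mult_def Estar_def mult_delta_right cong: conj_cong)

lemma Estar_apply: "(Estar E x i *v v) $ y = (if gdist E x y = i then v $ y else 0)"
  by (cases "gdist E x y = i") (simp_all add: matrix_vector_mult_def Estar_def mult_delta_left)

lemma gdist_le_eccentricity: "gdist E x y \<le> eccentricity E x"
proof -
  have "{gdist E x y | y. True} = range (gdist E x)" by auto
  then show ?thesis unfolding eccentricity_def by (intro Max_ge) auto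
qed

text \<open>Only the summand whose index is the distance from \<open>x\<close> to \<open>z\<close>
  can contribute.\<close>

lemma lowering_entry:
  "lowering E x $ y $ z = (if E y z \<and> gdist E x z = gdist E x y + 1 then 1 else 0)"
proof -
  have "lowering E x $ y $ z = (\<Sum>i\<in>{1..eccentricity E x}.
      if i = gdist E x z then (if E y z \<and> gdist E x z = gdist E x y + 1 then 1 else 0) else 0)"
    unfolding lowering_def sum_component Estar_mult_right Estar_mult_left adj_matrix_def
    by (intro sum.cong) auto
  then show ?thesis using gdist_le_eccentricity[of E x z] by auto
qed

lemma raising_entry:
  "raising E x $ y $ z = (if E y z \<and> gdist E x y = gdist E x z + 1 then 1 else 0)"
proof -
  have "raising E x $ y $ z = (\<Sum>i\<in>{0..<eccentricity E x}.
      if i = gdist E x z then (if E y z \<and> gdist E x y = gdist E x z + 1 then 1 else 0) else 0)"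
    unfolding raising_def sum_component Estar_mult_right Estar_mult_left adj_matrix_def
    by (intro sum.cong) auto
  then show ?thesis using gdist_le_eccentricity[of E x y] by auto
qed

context tight_q1
begin

text \<open>Seen from the antipode of x, lowering becomes raising.\<close>

lemma gdist_antipode: "d x y + d (antipode x) y = D"
  using d_antipode[of x y] d_sym[of y] by simp

lemma lowering_flat: "lowering (flat_graph E x) x *v v = (\<chi> y. up (antipode x) (\<lambda>z. v $ z) y)"
proof -
  have "(lowering (flat_graph E x) x *v v) $ y = up (antipode x) (\<lambda>z. v $ z) y" for y
  proof -
    have "(flat_graph E x y z \<and> d x z = d x y + 1) \<longleftrightarrow>
        (E y z \<and> d (antipode x) z + 1 = d (antipode x) y)" for z
      using gdist_antipode[of x y] gdist_antipode[of x z] by (auto simp: flat_graph_def)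
    then show ?thesis
      unfolding matrix_vector_mult_def lowering_entry gdist_flat up_def
      by (simp add: if_distrib[where f="\<lambda>t. t * _"] sum.If_cases cong: if_cong)
  qed
  then show ?thesis by (simp add: Finite_Cartesian_Product.vec_eq_iff)
qed

lemma raising_flat: "raising (flat_graph E x) x *v v = (\<chi> y. dn (antipode x) (\<lambda>z. v $ z) y)"
proof -
  have "(raising (flat_graph E x) x *v v) $ y = dn (antipode x) (\<lambda>z. v $ z) y" for y
  proof -
    have "(flat_graph E x y z \<and> d x y = d x z + 1) \<longleftrightarrow>
        (E y z \<and> d (antipode x) z = d (antipode x) y + 1)" for z
      using gdist_antipode[of x y] gdist_antipode[of x z] by (auto simp: flat_graph_def)
    then show ?thesis
      unfolding matrix_vector_mult_def raising_entry gdist_flat dn_def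
      by (simp add: if_distrib[where f="\<lambda>t. t * _"] sum.If_cases cong: if_cong)
  qed
  then show ?thesis by (simp add: Finite_Cartesian_Product.vec_eq_iff)
qed

lemma eccentricity_flat: "eccentricity (flat_graph E x) x = D"
  unfolding eccentricity_def gdist_flat
proof (rule Max_eqI)
  have "{d x y |y. True} = range (d x)" by auto
  then show "finite {d x y |y. True}" by simp
  have "d x (antipode x) = D" using antipode_iff[of x "antipode x"] by simp
  then show "D \<in> {d x y |y. True}" by (intro CollectI exI[of _ "antipode x"]) simp
qed (use d_le_D in auto)

text \<open>The i-th subconstituent of \<open>x\<close> is level D - i of the antipode, so the
  matrix identity becomes one for \<open>up\<close> (in place of L) and \<open>dn\<close> (in place
  of R).\<close>

lemma uniform_equation:
  assumes "supports_uniform_structure E x"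
  obtains U f where "parameter_matrix D U"
    and "\<And>i v y. \<lbrakk>i \<in> {1..D}; level (antipode x) (D - i) v\<rbrakk> \<Longrightarrow>
      e_minus U i * dn (antipode x) (up (antipode x) (up (antipode x) v)) y
      + up (antipode x) (dn (antipode x) (up (antipode x) v)) y
      + e_plus D U i * up (antipode x) (up (antipode x) (dn (antipode x) v)) y
      = f i * up (antipode x) v y"
proof -
  let ?F = "flat_graph E x" and ?p = "antipode x"
  let ?L = "lowering ?F x" and ?R = "raising ?F x"
  obtain U f where U: "parameter_matrix D U"
    and eq: "\<And>i v. \<lbrakk>i \<in> {1..D}; v \<in> Estar_space ?F x i\<rbrakk> \<Longrightarrow>
      e_minus U i *s ((?R ** ?L ** ?L) *v v) + (?L ** ?R ** ?L) *v v
        + e_plus D U i *s ((?L ** ?L ** ?R) *v v) = f i *s (?L *v v)"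
    using assms unfolding supports_uniform_structure_def admits_uniform_structure_def Let_def eccentricity_flat
    by blast
  have "e_minus U i * dn ?p (up ?p (up ?p v)) y + up ?p (dn ?p (up ?p v)) y
      + e_plus D U i * up ?p (up ?p (dn ?p v)) y = f i * up ?p v y"
    if i: "i \<in> {1..D}" and v: "level ?p (D - i) v" for i v y
  proof -
    let ?v = "\<chi> y. v y"
    have "v y = 0" if "d x y \<noteq> i" for y
      using v that gdist_antipode[of x y] i unfolding level_def by auto
    then have "Estar ?F x i *v ?v = ?v"
      by (simp add: Finite_Cartesian_Product.vec_eq_iff Estar_apply gdist_flat)
    then have "?v \<in> Estar_space ?F x i" unfolding Estar_space_def by (metis rangeI)
    from eq[OF i this] have "(e_minus U i *s ((?R ** ?L ** ?L) *v ?v) + (?L ** ?R ** ?L) *v ?v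
        + e_plus D U i *s ((?L ** ?L ** ?R) *v ?v)) $ y = (f i *s (?L *v ?v)) $ y" by simp
    then show ?thesis
      by (simp add: matrix_vector_mul_assoc[symmetric] lowering_flat raising_flat)
  qed
  then show thesis using that U by blast
qed

text \<open>Summing the uniform equations along the chain v, up v, up (up v), ... and solving for
  \<open>up\<^bsup>D-2\<^esup> (dn (up v))\<close> shows that this is a multiple of \<open>up\<^bsup>D-2\<^esup> v\<close>, with a factor depending on U
  and f only.\<close>

lemma uniform_scalar:
  assumes "supports_uniform_structure E x"
  obtains \<xi> where "\<And>v w. \<lbrakk>level (antipode x) 1 v; (\<Sum>w | E (antipode x) w. v w) = 0\<rbrakk> \<Longrightarrow>
    (up (antipode x) ^^ (D - 2)) (dn (antipode x) (up (antipode x) v)) w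
      = \<xi> * (up (antipode x) ^^ (D - 2)) v w"
proof -
  let ?p = "antipode x"
  obtain U f where U: "parameter_matrix D U"
    and eq: "\<And>i v y. \<lbrakk>i \<in> {1..D}; level ?p (D - i) v\<rbrakk> \<Longrightarrow>
      e_minus U i * dn ?p (up ?p (up ?p v)) y + up ?p (dn ?p (up ?p v)) y
      + e_plus D U i * up ?p (up ?p (dn ?p v)) y = f i * up ?p v y"
    using uniform_equation[OF assms] by blast
  \<comment> \<open>Rows 1 and \<open>D\<close> are dropped: the unknowns with these indices vanish
    and serve as boundary values.\<close>
  obtain X where X: "\<And>z c i. \<lbrakk>z (2 - 1) = 0; z (D - 1 + 1) = 0;
      \<And>i. i \<in> {2..D - 1} \<Longrightarrow> e_minus U i * z (i - 1) + z i + e_plus D U i * z (i + 1) = f i * c;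
      i \<in> {2..D - 1}\<rbrakk> \<Longrightarrow> z i = X i * c"
  proof -
    have "(1::nat) \<le> 2" "2 \<le> D - 1" "D - 1 \<le> D" using D3 by auto
    then show thesis by (rule parameter_matrix_solution[OF U, of 2 "D - 1" f]) (fact that)
  qed
  show thesis
  proof (rule that)
    fix v w
    assume v1: "level ?p 1 v" and v0: "(\<Sum>w | E ?p w. v w) = 0"
    \<comment> \<open>All \<open>u j\<close> lie in level D - 1. The reversed index in
      \<open>z\<close> matches the numbering of the equations, since equation i starts in level D -
      i.\<close>
    define u where "u j = (up ?p ^^ (D - j)) (dn ?p ((up ?p ^^ (j - 1)) v))" for j
    define z where "z i = u (D + 1 - i) w" for i
    define c where "c = (up ?p ^^ (D - 2)) v w"
    have "u D = (\<lambda>y. 0)"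
      unfolding u_def up_power_top[OF v1 v0] by (simp add: dn_def fun_eq_iff)
    then have z1: "z (2 - 1) = 0" by (simp add: z_def)
    have "u 1 = (\<lambda>y. 0)"
      unfolding u_def using dn_trace_zero[OF v1 v0] by (simp add: up_power_zero)
    then have zD: "z (D - 1 + 1) = 0" using D3 by (simp add: z_def)
    have rows: "e_minus U i * z (i - 1) + z i + e_plus D U i * z (i + 1) = f i * c" if i: "i \<in> {2..D - 1}" for i
    proof -
      define j where "j = D - i"
      \<comment> \<open>Equation i lands in level j + 1; m further raisings bring it to level D - 1,
        where all equations share the term \<open>c\<close>.\<close>
      define m where "m = D - 2 - j"
      have j: "1 \<le> j" "D = j + 2 + m" "i = m + 2" using i by (auto simp: j_def m_def)
      let ?v = "(up ?p ^^ (j - 1)) v"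
      have "level ?p j ?v" using level_up_power[OF v1, of "j - 1"] j(1) by simp
      then have "level ?p (D - i) ?v" unfolding j_def .
      moreover have "i \<in> {1..D}" using i by auto
      ultimately have "(\<lambda>y. e_minus U i * dn ?p (up ?p (up ?p ?v)) y + up ?p (dn ?p (up ?p ?v)) y
          + e_plus D U i * up ?p (up ?p (dn ?p ?v)) y) = (\<lambda>y. f i * up ?p ?v y)"
        using eq by blast
      then have "(up ?p ^^ m) (\<lambda>y. e_minus U i * dn ?p (up ?p (up ?p ?v)) y + up ?p (dn ?p (up ?p ?v)) y
          + e_plus D U i * up ?p (up ?p (dn ?p ?v)) y) w = (up ?p ^^ m) (\<lambda>y. f i * up ?p ?v y) w"
        by simp
      then have "e_minus U i * (up ?p ^^ m) (dn ?p (up ?p (up ?p ?v))) w + (up ?p ^^ m) (up ?p (dn ?p (up ?p ?v))) w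
          + e_plus D U i * (up ?p ^^ m) (up ?p (up ?p (dn ?p ?v))) w = f i * (up ?p ^^ m) (up ?p ?v) w"
        unfolding up_power_add up_power_scale .
      moreover have "up ?p ?v = (up ?p ^^ j) v" using j(1) by (cases j) auto
      moreover have "(up ?p ^^ m) (up ?p g) = (up ?p ^^ (m + 1)) g" for g
        by (simp add: funpow_swap1)
      moreover have "(up ?p ^^ m) (up ?p (up ?p g)) = (up ?p ^^ (m + 2)) g" for g
        by (simp add: funpow_swap1)
      moreover have "(up ?p ^^ m) ((up ?p ^^ j) v) = (up ?p ^^ (D - 2)) v"
      proof -
        have "m + j = D - 2" using j by simp
        then show ?thesis by (simp only: up_power_add')
      qed
      moreover have "up ?p ((up ?p ^^ j) v) = (up ?p ^^ (j + 1)) v" by simp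
      moreover have "z (i - 1) = (up ?p ^^ m) (dn ?p ((up ?p ^^ (j + 1)) v)) w"
        "z i = (up ?p ^^ (m + 1)) (dn ?p ((up ?p ^^ j) v)) w"
        "z (i + 1) = (up ?p ^^ (m + 2)) (dn ?p ?v) w"
        unfolding z_def u_def using j by (simp_all del: funpow.simps)
      ultimately show ?thesis by (simp only: c_def)
    qed
    \<comment> \<open>The wanted vector is \<open>u 2\<close>, that is, the last unknown of the
      block.\<close>
    have "z (D - 1) = X (D - 1) * c"
      using D3 by (intro X z1 zD rows) auto
    then show "(up ?p ^^ (D - 2)) (dn ?p (up ?p v)) w = X (D - 1) * (up ?p ^^ (D - 2)) v w"
      using D3 by (simp add: z_def u_def c_def)
  qed
qed

lemma no_uniform_structure: "\<not> supports_uniform_structure E x"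
proof
  assume uniform: "supports_uniform_structure E x"
  obtain \<xi> where \<xi>: "\<And>v w. \<lbrakk>level (antipode x) 1 v; (\<Sum>w | E (antipode x) w. v w) = 0\<rbrakk> \<Longrightarrow>
    (up (antipode x) ^^ (D - 2)) (dn (antipode x) (up (antipode x) v)) w
      = \<xi> * (up (antipode x) ^^ (D - 2)) v w"
  proof -
    show thesis by (rule uniform_scalar[OF uniform]) (fact that)
  qed
  let ?p = "antipode x"
  have "dn ?p (up ?p v) y = \<xi> * v y"
    if v1: "level ?p 1 v" and v0: "(\<Sum>w | E ?p w. v w) = 0" and y: "E ?p y" for v y
  proof -
    let ?g = "\<lambda>y. dn ?p (up ?p v) y + (- \<xi>) * v y"
    have "(up ?p ^^ (D - 2)) ?g = (\<lambda>y. 0)"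
      unfolding up_power_add up_power_scale \<xi>[OF v1 v0] by simp
    \<comment> \<open>Injectivity applies only to vectors with sum zero; \<open>?g\<close> is one
      because \<open>dn\<close> after \<open>up\<close> is a polynomial in \<open>loc\<close>
      there.\<close>
    moreover have "(\<Sum>w | E ?p w. ?g w) = (\<Sum>w | E ?p w.
        (of_real (bb 0 - cc 2 - 2 * zeta) * v w + of_real zeta * loc ?p v w) + (- \<xi>) * v w)"
      by (rule sum.cong[OF refl]) (simp only: dn_up_trace_zero[OF v0] mem_Collect_eq)
    then have "(\<Sum>w | E ?p w. ?g w) = 0"
      by (simp only: sum.distrib sum_distrib_left[symmetric] sum_loc v0) simp
    ultimately have "?g y = 0" using y by (intro up_power_injective[where p = ?p and v = ?g])
    then show ?thesis by simp
  qed
  then show False by (rule dn_up_not_scalar)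
qed

end

theorem theorem9p2:
  fixes E :: "'a::finite graph" and x :: 'a and D :: nat and \<alpha> \<beta> :: real
  assumes "simple_connected_graph E"
    and "\<not> bipartite_graph E"
    and "distance_regular E"
    and "D \<ge> 3"
    and "classical_parameters_q1 E D \<alpha> \<beta>"
    and "tight_graph E"
  shows "\<not> supports_uniform_structure E x"
proof -
  interpret tight_q1 E D \<alpha> \<beta>
    by unfold_locales (use assms in auto)
  show ?thesis by (rule no_uniform_structure)
qed

end
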